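(* Let $A$ be any finite group of odd order acting $\mathbf F_2$-linearly and fixed-point-freely (meaning $C_V(A)=0$) on a finite $\mathbf F_2$-vector space $V$, and let $G=B\rtimes V$ with $B=\{f:V\to\mathbf F_2\}$, with the action of $A$ on $G$ described in the context. If $(A,V)$ is balanced, i.e. $V$ has an $A$-stable subset of size $|V|/2$, then $C=C_G(A)$ is elementary abelian, $$|\operatorname{Irr}_A(G)|=|C/C'|,\qquad\text{and}\qquad |N_A(G)|<|C/C'| .$$ In particular, for the coprime action of $A$ on $G$, the equality $|N_A(G)|=|C/C'|$ fails, and the statement "for every $\chi\in\operatorname{Irr}_A(G)$, $\chi^*(1)=1$ if and only if $\chi_C$ is never zero" fails.
   Context: Groups are finite and characters complex. $C_V(A)=\{v\in V: a\cdot v=v\ \forall a\in A\}$. $B$ is the additive group of all functions $V\to\mathbf F_2$; for $t\in V$, $(\tau_tf)(x)=f(x+t)$; $G=B\rtimes V$ has multiplication $(f,t)(g,s)=(f+\tau_tg,\,t+s)$; $A$ acts on $G$ by automorphisms via $a\cdot(f,t)=(f\circ a^{-1},a\cdot t)$. $C=C_G(A)$ is the subgroup of $A$-fixed elements and $C'$ its derived subgroup. $\operatorname{Irr}_A(G)$ is the set of $A$-invariant irreducible characters of $G$ and $N_A(G)=\{\chi\in\operatorname{Irr}_A(G):\chi(c)\ne0\ \forall c\in C\}$. The map $\chi\mapsto\chi^*$ is the Glauberman--Isaacs correspondence, a canonical bijection $\operatorname{Irr}_A(G)\to\operatorname{Irr}(C)$ for coprime actions: when $A$ is a $p$-group, $\chi^*$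 is the unique irreducible constituent of $\chi_C$ with multiplicity not divisible by $p$; for solvable $A$ (groups of odd order are solvable) it is obtained by composing such maps along a subnormal series of $A$ with factors of prime power order. *)

theory Defs
  imports
    "HOL-Library.Z2"
    "HOL-Algebra.Generated_Groups"
    "HOL-Algebra.Group_Action"
    "Jordan_Normal_Form.VS_Connect"
begin

section \<open>Complex characters of a finite group\<close>

definition mat_trace :: "complex mat \<Rightarrow> complex" where
  "mat_trace M = (\<Sum>i<dim_row M. M $$ (i, i))"

definition representation :: "('g, 'm) monoid_scheme \<Rightarrow> nat \<Rightarrow> ('g \<Rightarrow> complex mat) \<Rightarrow> bool" where
  "representation G n \<rho> \<longleftrightarrow> \<rho> \<in> hom G (units_of (ring_mat TYPE(complex) n ()))"

definition irreducible_representation ::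
    "('g, 'm) monoid_scheme \<Rightarrow> nat \<Rightarrow> ('g \<Rightarrow> complex mat) \<Rightarrow> bool" where
  "irreducible_representation G n \<rho> \<longleftrightarrow>
     representation G n \<rho> \<and> n \<noteq> 0 \<and>
     (\<forall>W. subspace class_ring W (module_vec TYPE(complex) n) \<and>
          (\<forall>g\<in>carrier G. \<forall>w\<in>W. \<rho> g *\<^sub>v w \<in> W)
        \<longrightarrow> W = {0\<^sub>v n} \<or> W = carrier_vec n)"

text \<open>
  Characters are extensional functions (\<open>undefined\<close> off the carrier), so that
  characters which agree on the carrier are equal and sets of characters have the right cardinality.
\<close>

definition Irr :: "('g, 'm) monoid_scheme \<Rightarrow> ('g \<Rightarrow> complex) set" where
  "Irr G = {\<lambda>g\<in>carrier G. mat_trace (\<rho> g) | n \<rho>. irreducible_representation G n \<rho>}"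

section \<open>Actions by automorphisms\<close>

definition acts_by_automorphisms ::
    "('a, 'k) monoid_scheme \<Rightarrow> ('g, 'm) monoid_scheme \<Rightarrow> ('a \<Rightarrow> 'g \<Rightarrow> 'g) \<Rightarrow> bool" where
  "acts_by_automorphisms A G \<phi> \<longleftrightarrow> group_hom A (AutoGroup G) \<phi>"

definition coprime_action ::
    "('a, 'k) monoid_scheme \<Rightarrow> ('g, 'm) monoid_scheme \<Rightarrow> ('a \<Rightarrow> 'g \<Rightarrow> 'g) \<Rightarrow> bool" where
  "coprime_action A G \<phi> \<longleftrightarrow> acts_by_automorphisms A G \<phi> \<and>
     finite (carrier A) \<and> finite (carrier G) \<and> coprime (Coset.order A) (Coset.order G)"

text \<open>
  In the next two definitions \<open>K\<close> is a subset of the acting group rather than the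
  whole of it, since the Glauberman--Isaacs correspondence uses subgroups of the acting group.
\<close>

definition fixed_subgroup ::
    "('g, 'm) monoid_scheme \<Rightarrow> ('a \<Rightarrow> 'g \<Rightarrow> 'g) \<Rightarrow> 'a set \<Rightarrow> ('g, 'm) monoid_scheme" where
  "fixed_subgroup G \<phi> K = G\<lparr>carrier := {g \<in> carrier G. \<forall>a\<in>K. \<phi> a g = g}\<rparr>"

definition Irr_inv ::
    "('g, 'm) monoid_scheme \<Rightarrow> ('a \<Rightarrow> 'g \<Rightarrow> 'g) \<Rightarrow> 'a set \<Rightarrow> ('g \<Rightarrow> complex) set" where
  "Irr_inv G \<phi> K = {\<chi> \<in> Irr G. \<forall>a\<in>K. \<forall>g\<in>carrier G. \<chi> (\<phi> a g) = \<chi> g}"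

definition N_inv ::
    "('g, 'm) monoid_scheme \<Rightarrow> ('a \<Rightarrow> 'g \<Rightarrow> 'g) \<Rightarrow> 'a set \<Rightarrow> ('g \<Rightarrow> complex) set" where
  "N_inv G \<phi> K =
     {\<chi> \<in> Irr_inv G \<phi> K. \<forall>c\<in>carrier (fixed_subgroup G \<phi> K). \<chi> c \<noteq> 0}"

section \<open>The Glauberman--Isaacs correspondence\<close>

text \<open>
  The function \<open>m\<close> gives the multiplicities of the irreducible characters of \<open>H\<close>
  in the restriction of \<open>\<theta>\<close> to the subgroup \<open>H\<close>.  The predicate says
  that \<open>\<psi>\<close> is the unique irreducible constituent whose multiplicity is not
  divisible by \<open>p\<close>.
\<close>

definition unique_constituent_not_dvd ::
    "nat \<Rightarrow> ('g, 'm) monoid_scheme \<Rightarrow> ('g \<Rightarrow> complex) \<Rightarrow> ('g \<Rightarrow> complex) \<Rightarrow> bool" where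
  "unique_constituent_not_dvd p H \<theta> \<psi> \<longleftrightarrow> \<psi> \<in> Irr H \<and>
     (\<exists>m :: ('g \<Rightarrow> complex) \<Rightarrow> nat.
        (\<forall>h\<in>carrier H. \<theta> h = (\<Sum>\<eta>\<in>Irr H. of_nat (m \<eta>) * \<eta> h)) \<and>
        (\<forall>\<eta>\<in>Irr H. \<not> p dvd m \<eta> \<longleftrightarrow> \<eta> = \<psi>))"

text \<open>
  \<open>GI_corresponds A G \<phi> K \<chi> \<psi>\<close>: composing the maps for groups of prime power order
  along some series \<open>1 = A\<^sub>0 \<lhd> A\<^sub>1 \<lhd> \<dots> \<lhd> A\<^sub>r = K\<close> of subgroups of \<open>A\<close>,
  each factor of prime power order, takes the \<open>K\<close>-invariant character \<open>\<chi>\<close> of \<open>G\<close> to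
  the character \<open>\<psi>\<close> of \<open>C\<^sub>G(K)\<close>.  The step from \<open>H = A\<^sub>i\<close> to \<open>K = A\<^sub>i\<^sub>+\<^sub>1\<close> is the
  correspondence for the action of the \<open>p\<close>-group \<open>K/H\<close> on \<open>C\<^sub>G(H)\<close>, whose fixed subgroup is
  \<open>C\<^sub>G(K)\<close>.
\<close>

inductive GI_corresponds ::
    "('a, 'k) monoid_scheme \<Rightarrow> ('g, 'm) monoid_scheme \<Rightarrow> ('a \<Rightarrow> 'g \<Rightarrow> 'g) \<Rightarrow> 'a set
      \<Rightarrow> ('g \<Rightarrow> complex) \<Rightarrow> ('g \<Rightarrow> complex) \<Rightarrow> bool"
  for A G \<phi> where
  trivial: "\<chi> \<in> Irr G \<Longrightarrow> GI_corresponds A G \<phi> {\<one>\<^bsub>A\<^esub>} \<chi> \<chi>"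
| step: "\<lbrakk>GI_corresponds A G \<phi> H \<chi> \<theta>;
          subgroup K A; H \<lhd> (A\<lparr>carrier := K\<rparr>);
          prime p; Coset.order ((A\<lparr>carrier := K\<rparr>) Mod H) = p ^ e;
          \<theta> \<in> Irr_inv (fixed_subgroup G \<phi> H) \<phi> K;
          unique_constituent_not_dvd p (fixed_subgroup G \<phi> K) \<theta> \<psi>\<rbrakk>
         \<Longrightarrow> GI_corresponds A G \<phi> K \<chi> \<psi>"

text \<open>
  The correspondence is a map on \<open>A\<close>-invariant irreducible characters. By the theorems of
  Glauberman and Isaacs, for solvable \<open>A\<close> acting coprimely it exists, is independent of the
  series, and is a bijection onto \<open>Irr (C\<^sub>G(A))\<close>; none of this is part of the definition.
  The values of \<open>star\<close> outside \<open>Irr_inv G \<phi> (carrier A)\<close> are irrelevant.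
\<close>

definition is_GI_correspondence ::
    "('a, 'k) monoid_scheme \<Rightarrow> ('g, 'm) monoid_scheme \<Rightarrow> ('a \<Rightarrow> 'g \<Rightarrow> 'g)
      \<Rightarrow> (('g \<Rightarrow> complex) \<Rightarrow> ('g \<Rightarrow> complex)) \<Rightarrow> bool" where
  "is_GI_correspondence A G \<phi> star \<longleftrightarrow>
     (\<forall>\<chi>\<in>Irr_inv G \<phi> (carrier A). GI_corresponds A G \<phi> (carrier A) \<chi> (star \<chi>))"

section \<open>The group \<open>B \<rtimes> V\<close> and the action on it\<close>

definition elementary_abelian :: "('g, 'm) monoid_scheme \<Rightarrow> bool" where
  "elementary_abelian G \<longleftrightarrow>
     comm_group G \<and> (\<exists>p::nat. prime p \<and> (\<forall>g\<in>carrier G. g [^]\<^bsub>G\<^esub> p = \<one>\<^bsub>G\<^esub>))"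

text \<open>
  An \<open>\<bbbF>\<^sub>2\<close>-linear action on the vector space with underlying type \<open>'v\<close> and scalar
  multiplication \<open>scale\<close>.
\<close>

definition linear_action ::
    "('a, 'k) monoid_scheme \<Rightarrow> (bit \<Rightarrow> 'v \<Rightarrow> 'v::ab_group_add) \<Rightarrow> ('a \<Rightarrow> 'v \<Rightarrow> 'v) \<Rightarrow> bool" where
  "linear_action A scale act \<longleftrightarrow>
     group_action A UNIV act \<and> (\<forall>a\<in>carrier A. Vector_Spaces.linear scale scale (act a))"

definition fixed_point_free ::
    "('a, 'k) monoid_scheme \<Rightarrow> ('a \<Rightarrow> 'v \<Rightarrow> 'v::ab_group_add) \<Rightarrow> bool" where
  "fixed_point_free A act \<longleftrightarrow> {v. \<forall>a\<in>carrier A. act a v = v} = {0}"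

text \<open>
  The size condition avoids division on \<open>nat\<close>, which would make the empty subset of a
  one-element \<open>V\<close> a witness.
\<close>

definition balanced :: "('a, 'k) monoid_scheme \<Rightarrow> ('a \<Rightarrow> 'v \<Rightarrow> 'v) \<Rightarrow> bool" where
  "balanced A act \<longleftrightarrow>
     (\<exists>S. (\<forall>a\<in>carrier A. act a ` S = S) \<and> 2 * card S = card (UNIV :: 'v set))"

definition function_semidirect :: "(('v::ab_group_add \<Rightarrow> bit) \<times> 'v) monoid" where
  "function_semidirect =
     \<lparr>carrier = UNIV,
      mult = \<lambda>(f, t) (g, s). (\<lambda>x. f x + g (x + t), t + s),
      one = (\<lambda>_. 0, 0)\<rparr>"

definition semidirect_action ::
    "('a, 'k) monoid_scheme \<Rightarrow> ('a \<Rightarrow> 'v \<Rightarrow> 'v)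
      \<Rightarrow> 'a \<Rightarrow> ('v \<Rightarrow> bit) \<times> 'v \<Rightarrow> ('v \<Rightarrow> bit) \<times> 'v" where
  "semidirect_action A act a = (\<lambda>(f, t). (f \<circ> act (inv\<^bsub>A\<^esub> a), act a t))"

end

theory Submission
  imports Defs
begin

text \<open>
  Identify the linear characters of the elementary abelian normal subgroup
  \<open>B = {f. f :: V \<rightarrow> F\<^sub>2}\<close> of \<open>G\<close> with functions \<open>u :: V \<rightarrow> F\<^sub>2\<close>, by letting \<open>u\<close> act as
  \<open>f \<mapsto> (-1)\<^bsup>\<Sum> u(x) f(x)\<^esup>\<close>; this is \<open>pairing u\<close>.  The complement \<open>V\<close> permutes them by
  translation.  By Clifford theory an irreducible character of \<open>G\<close> amounts to a translation
  orbit \<open>O\<close> of some \<open>u\<close> together with a linear character \<open>\<mu>\<close> of the stabilizer \<open>T\<close> of \<open>u\<close> in \<open>V\<close>: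
  it vanishes at \<open>(f, t)\<close> unless \<open>t\<close> lies in \<open>T\<close>, and there it is \<open>\<mu> t\<close> times the sum of
  \<open>pairing u' f\<close> over \<open>u'\<close> in \<open>O\<close>
  (\<open>irreducible_character_eq_twisted_orbit_character\<close>, \<open>orbit_character_in_Irr\<close>).

  Now let \<open>A\<close> act.  Adding up the elements \<open>act a t\<close> over all \<open>a\<close> in \<open>A\<close> gives a fixed vector of
  \<open>V\<close>, hence \<open>0\<close>, whereas adding up \<open>card A\<close> copies of \<open>t\<close> gives \<open>t\<close>, because \<open>card A\<close> is odd and
  \<open>V\<close> has exponent two.  This averaging has three consequences.  An \<open>A\<close>-stable translation orbit
  contains an \<open>A\<close>-fixed function (\<open>fixed_function_in_stable_translates\<close>), it contains only one
  (\<open>fixed_translate_eq\<close>), and an \<open>A\<close>-invariant character \<open>\<mu>\<close> of its stabilizer is trivial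
  (\<open>invariant_sign_character_trivial\<close>).  So the \<open>A\<close>-invariant irreducible characters of \<open>G\<close>
  correspond bijectively to the \<open>A\<close>-fixed functions \<open>u\<close>.  The group \<open>C\<close> consists of the pairs
  \<open>(f, 0)\<close> with \<open>f\<close> an \<open>A\<close>-fixed function, so it is elementary abelian and has just as many
  elements as there are \<open>A\<close>-invariant irreducible characters.

  The function \<open>u\<close> supported at \<open>0\<close> is \<open>A\<close>-fixed, and its translates are all the functions
  supported at one point.  Its character therefore takes the value
  \<open>\<Sum> (-1)\<^bsup>f(y)\<^esup> = card V - 2 * card {y. f y = 1}\<close> at \<open>(f, 0)\<close>, which is zero when \<open>f\<close> is the
  indicator function of an \<open>A\<close>-stable half of \<open>V\<close>.  So not all the invariant characters are
  nowhere zero on \<open>C\<close>; but their correspondents are irreducible characters of an abelian group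
  and all have degree one.
\<close>

section \<open>Representations and intertwining matrices\<close>

lemma subspace_iff_closed:
  fixes W :: "complex vec set"
  shows "VectorSpace.subspace class_ring W (module_vec TYPE(complex) n) \<longleftrightarrow>
    W \<subseteq> carrier_vec n \<and> 0\<^sub>v n \<in> W \<and> (\<forall>v\<in>W. \<forall>w\<in>W. v + w \<in> W) \<and> (\<forall>c. \<forall>w\<in>W. c \<cdot>\<^sub>v w \<in> W)"
    (is "?L \<longleftrightarrow> ?R")
proof
  assume ?L
  then interpret VectorSpace.subspace class_ring W "module_vec TYPE(complex) n" .
  have sub: "submodule class_ring W (module_vec TYPE(complex) n)" by (rule submod)
  show ?R
    using sub unfolding submodule_def by (auto simp: module_vec_simps class_ring_simps)
next
  assume R: ?R
  have "vectorspace class_ring (module_vec TYPE(complex) n)" by (rule vec_vs)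
  moreover have "submodule class_ring W (module_vec TYPE(complex) n)"
    using R vec_module unfolding submodule_def
    by (auto simp: module_vec_simps class_ring_simps)
  ultimately show ?L by (simp add: VectorSpace.subspace_def)
qed

lemma representation_carrier:
  assumes "representation G n \<rho>" "g \<in> carrier G"
  shows "\<rho> g \<in> carrier_mat n n"
  using assms unfolding representation_def hom_def units_of_def Units_def
  by (auto simp: ring_mat_simps)

lemma representation_mult:
  assumes "representation G n \<rho>" "g \<in> carrier G" "h \<in> carrier G"
  shows "\<rho> (g \<otimes>\<^bsub>G\<^esub> h) = \<rho> g * \<rho> h"
  using assms unfolding representation_def hom_def units_of_def by (auto simp: ring_mat_simps)

lemma representation_one:
  assumes "group G" "representation G n \<rho>"
  shows "\<rho> \<one>\<^bsub>G\<^esub> = 1\<^sub>m n"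
proof -
  interpret ring "ring_mat TYPE(complex) n ()" by (rule ring_mat)
  have "group_hom G (units_of (ring_mat TYPE(complex) n ())) \<rho>"
    using assms units_group by (auto simp: group_hom_def group_hom_axioms_def representation_def)
  from group_hom.hom_one[OF this] show ?thesis by (simp add: units_of_def ring_mat_simps)
qed

lemma representationI:
  assumes "group G"
    and car: "\<And>g. g \<in> carrier G \<Longrightarrow> \<sigma> g \<in> carrier_mat n n"
    and mult: "\<And>g h. g \<in> carrier G \<Longrightarrow> h \<in> carrier G \<Longrightarrow> \<sigma> (g \<otimes>\<^bsub>G\<^esub> h) = \<sigma> g * \<sigma> h"
    and one: "\<sigma> \<one>\<^bsub>G\<^esub> = 1\<^sub>m n"
  shows "representation G n \<sigma>"
proof -
  interpret group G by fact
  have "\<exists>N\<in>carrier_mat n n. N * \<sigma> g = 1\<^sub>m n \<and> \<sigma> g * N = 1\<^sub>m n" if "g \<in> carrier G" for g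
    using that car one by (intro bexI[of _ "\<sigma> (inv\<^bsub>G\<^esub> g)"]) (auto simp flip: mult)
  then show ?thesis
    using car mult unfolding representation_def hom_def units_of_def Units_def
    by (auto simp: ring_mat_simps)
qed

lemma subspace_closed_sum:
  fixes W :: "complex vec set"
  assumes W: "VectorSpace.subspace class_ring W (module_vec TYPE(complex) n)"
    and "finite F" "\<And>f. f \<in> F \<Longrightarrow> h f \<in> W"
  shows "vec n (\<lambda>i. \<Sum>f\<in>F. h f $ i) \<in> W"
  using assms(2,3)
proof (induction F)
  case empty
  have "vec n (\<lambda>i. 0) = (0\<^sub>v n :: complex vec)" by auto
  then show ?case using W by (simp add: subspace_iff_closed)
next
  case (insert f F)
  have "h f \<in> carrier_vec n" using W insert.prems unfolding subspace_iff_closed by blast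
  then have "vec n (\<lambda>i. \<Sum>f\<in>insert f F. h f $ i) = h f + vec n (\<lambda>i. \<Sum>f\<in>F. h f $ i)"
    using insert.hyps by (intro eq_vecI) auto
  also have "\<dots> \<in> W" using W insert unfolding subspace_iff_closed by auto
  finally show ?case .
qed

lemma mat_trace_comm:
  assumes "M \<in> carrier_mat n m" "N \<in> carrier_mat m n"
  shows "mat_trace (M * N) = mat_trace (N * M)"
proof -
  have "mat_trace (M * N) = (\<Sum>i<n. \<Sum>j<m. M $$ (i,j) * N $$ (j,i))"
    using assms by (simp add: mat_trace_def scalar_prod_def atLeast0LessThan)
  also have "\<dots> = (\<Sum>j<m. \<Sum>i<n. N $$ (j,i) * M $$ (i,j))"
    by (subst sum.swap) (simp add: mult.commute)
  also have "\<dots> = mat_trace (N * M)"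
    using assms by (simp add: mat_trace_def scalar_prod_def atLeast0LessThan)
  finally show ?thesis .
qed

lemma mult_unit_vec_eq_col:
  assumes "M \<in> carrier_mat n m" "j < m"
  shows "M *\<^sub>v unit_vec m j = (col M j :: complex vec)"
  using assms by (intro eq_vecI) (auto simp: scalar_prod_right_unit)

lemma mat_eqI_mult_vec:
  fixes M N :: "complex mat"
  assumes "M \<in> carrier_mat n m" "N \<in> carrier_mat n m"
    "\<And>x. x \<in> carrier_vec m \<Longrightarrow> M *\<^sub>v x = N *\<^sub>v x"
  shows "M = N"
proof (rule mat_col_eqI)
  fix j assume "j < dim_col N"
  then have j: "j < m" using assms by simp
  then show "col M j = col N j"
    using assms(3)[of "unit_vec m j"] assms(1,2)
    by (metis mult_unit_vec_eq_col unit_vec_carrier)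
qed (use assms in auto)

text \<open>
  The image of an intertwining matrix \<open>M\<close> is invariant, so irreducibility makes \<open>M\<close> surjective.
  A trivial kernel then makes it invertible, and conjugation by \<open>M\<close> preserves traces.  The
  matrices \<open>S g\<close> describe the action of \<open>\<rho>\<close> on a convenient basis, the columns of \<open>M\<close>, from
  which its character can be read off.
\<close>

lemma irreducible_trace_eq_intertwined:
  fixes M :: "complex mat"
  assumes irr: "irreducible_representation G n \<rho>"
    and M: "M \<in> carrier_mat n m" and S: "\<And>g. g \<in> carrier G \<Longrightarrow> S g \<in> carrier_mat m m"
    and twine: "\<And>g. g \<in> carrier G \<Longrightarrow> \<rho> g * M = M * S g"
    and ker: "\<And>x. x \<in> carrier_vec m \<Longrightarrow> M *\<^sub>v x = 0\<^sub>v n \<Longrightarrow> x = 0\<^sub>v m"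
    and m: "m \<noteq> 0"
    and g: "g \<in> carrier G"
  shows "mat_trace (\<rho> g) = mat_trace (S g)"
proof -
  have rep: "representation G n \<rho>" using irr by (simp add: irreducible_representation_def)
  note car = representation_carrier[OF rep]
  define W where "W = (\<lambda>x. M *\<^sub>v x) ` carrier_vec m"
  have "VectorSpace.subspace class_ring W (module_vec TYPE(complex) n)"
    unfolding subspace_iff_closed
  proof (intro conjI ballI allI)
    show "W \<subseteq> carrier_vec n" using M by (auto simp: W_def)
    show "0\<^sub>v n \<in> W" using M by (auto simp: W_def intro!: image_eqI[of _ _ "0\<^sub>v m"])
    show "v + w \<in> W" if "v \<in> W" "w \<in> W" for v w
    proof -
      from that obtain x y where "x \<in> carrier_vec m" "y \<in> carrier_vec m" "v = M *\<^sub>v x" "w = M *\<^sub>v y"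
        unfolding W_def by blast
      then have "v + w = M *\<^sub>v (x + y)" "x + y \<in> carrier_vec m"
        using mult_add_distrib_mat_vec[OF M, of x y] by auto
      then show ?thesis unfolding W_def by blast
    qed
    show "c \<cdot>\<^sub>v w \<in> W" if "w \<in> W" for c w
    proof -
      from that obtain x where "x \<in> carrier_vec m" "w = M *\<^sub>v x"
        unfolding W_def by blast
      then have "c \<cdot>\<^sub>v w = M *\<^sub>v (c \<cdot>\<^sub>v x)" "c \<cdot>\<^sub>v x \<in> carrier_vec m"
        using mult_mat_vec[OF M, of x c] by auto
      then show ?thesis unfolding W_def by blast
    qed
  qed
  moreover have "\<rho> h *\<^sub>v w \<in> W" if h: "h \<in> carrier G" and w: "w \<in> W" for h w
  proof -
    obtain x where x: "x \<in> carrier_vec m" "w = M *\<^sub>v x" using w by (auto simp: W_def)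
    have "\<rho> h *\<^sub>v w = (\<rho> h * M) *\<^sub>v x" using car[OF h] M x by simp
    also have "\<dots> = M *\<^sub>v (S h *\<^sub>v x)" using twine[OF h] S[OF h] M x by simp
    finally show ?thesis using S[OF h] x by (auto simp: W_def)
  qed
  ultimately have "W = {0\<^sub>v n} \<or> W = carrier_vec n"
    using irr unfolding irreducible_representation_def by blast
  moreover have "W \<noteq> {0\<^sub>v n}"
  proof
    assume "W = {0\<^sub>v n}"
    then have "M *\<^sub>v unit_vec m 0 = 0\<^sub>v n" by (auto simp: W_def)
    then have "unit_vec m 0 = (0\<^sub>v m :: complex vec)" using ker by simp
    then have "unit_vec m 0 $ 0 = (0\<^sub>v m :: complex vec) $ 0" by simp
    then show False using m by simp
  qed
  ultimately have W: "W = carrier_vec n" by blast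
  have "\<exists>x. x \<in> carrier_vec m \<and> M *\<^sub>v x = unit_vec n j" for j
  proof -
    have "unit_vec n j \<in> (\<lambda>x. M *\<^sub>v x) ` carrier_vec m"
      using W unfolding W_def by simp
    then show ?thesis by (metis imageE)
  qed
  then obtain y where y: "\<And>j. y j \<in> carrier_vec m" "\<And>j. M *\<^sub>v y j = unit_vec n j" by metis
  \<comment> \<open>A right inverse of \<open>M\<close>, from preimages of the unit vectors.\<close>
  define N where "N = mat m n (\<lambda>(i,j). y j $ i)"
  have N: "N \<in> carrier_mat m n" by (simp add: N_def)
  have colN: "col N j = y j" if "j < n" for j
    using y(1)[of j] that by (auto simp: N_def intro!: eq_vecI)
  have MN: "M * N = 1\<^sub>m n"
  proof (rule mat_col_eqI)
    fix j assume "j < dim_col (1\<^sub>m n :: complex mat)"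
    then have j: "j < n" by simp
    then have "col (M * N) j = M *\<^sub>v col N j" using M N by (intro col_mult2) auto
    also have "\<dots> = unit_vec n j" using colN[OF j] y by simp
    finally show "col (M * N) j = col (1\<^sub>m n) j" using j by simp
  qed (use M N in auto)
  have NM: "N * M = 1\<^sub>m m"
  proof (rule mat_eqI_mult_vec)
    fix x :: "complex vec" assume x: "x \<in> carrier_vec m"
    define z where "z = N *\<^sub>v (M *\<^sub>v x)"
    have z: "z \<in> carrier_vec m" using M N x by (simp add: z_def)
    \<comment> \<open>A right inverse of an injective map is also a left inverse.\<close>
    have "M *\<^sub>v z = (M * N) *\<^sub>v (M *\<^sub>v x)" using M N x by (simp add: z_def)
    then have "M *\<^sub>v (z - x) = 0\<^sub>v n"
      using MN M x z by (simp add: mult_minus_distrib_mat_vec)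
    then have "z - x = 0\<^sub>v m" using ker x z by simp
    then have "z = x" using x z
      by (metis (no_types, lifting) carrier_vecD eq_vecI index_minus_vec(1) index_zero_vec(1) right_minus_eq)
    then show "(N * M) *\<^sub>v x = 1\<^sub>m m *\<^sub>v x" using M N x by (simp add: z_def)
  qed (use M N in auto)
  have "\<rho> g = \<rho> g * (M * N)" using car[OF g] MN by simp
  also have "\<dots> = (\<rho> g * M) * N" using car[OF g] M N by (simp add: assoc_mult_mat)
  also have "\<dots> = M * (S g * N)" using twine[OF g] S[OF g] M N by (simp add: assoc_mult_mat)
  finally have "mat_trace (\<rho> g) = mat_trace ((S g * N) * M)"
    using mat_trace_comm[OF M, of "S g * N"] S[OF g] N by simp
  also have "(S g * N) * M = S g" using NM S[OF g] M N by (simp add: assoc_mult_mat)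
  finally show ?thesis .
qed

text \<open>
  The involutions can be treated one at a time.  If \<open>w\<close> is an eigenvector of the earlier ones and
  \<open>M\<close> is the next, then either \<open>w + M w\<close> is zero, so that \<open>w\<close> is an eigenvector of \<open>M\<close> for
  \<open>-1\<close>, or \<open>w + M w\<close> is an eigenvector of \<open>M\<close> for \<open>1\<close>, which keeps the eigenvalues of \<open>w\<close>
  under the earlier involutions, since these commute with \<open>M\<close>.  The set \<open>K\<close> confines the
  search to an eigenspace of other matrices.
\<close>

lemma commuting_involutions_common_eigenvector:
  fixes F :: "complex mat set"
  assumes "finite F" and F: "F \<subseteq> carrier_mat n n"
    and inv: "\<And>M. M \<in> F \<Longrightarrow> M * M = 1\<^sub>m n"
    and comm: "\<And>M N. M \<in> F \<Longrightarrow> N \<in> F \<Longrightarrow> M * N = N * M"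
    and K: "K \<subseteq> carrier_vec n"
    and add: "\<And>v w. v \<in> K \<Longrightarrow> w \<in> K \<Longrightarrow> v + w \<in> K"
    and stable: "\<And>M v. M \<in> F \<Longrightarrow> v \<in> K \<Longrightarrow> M *\<^sub>v v \<in> K"
    and w0: "w\<^sub>0 \<in> K" "w\<^sub>0 \<noteq> 0\<^sub>v n"
  shows "\<exists>w\<in>K. w \<noteq> 0\<^sub>v n \<and> (\<forall>M\<in>F. \<exists>c\<in>{1,-1}. M *\<^sub>v w = c \<cdot>\<^sub>v w)"
  using assms(1) F inv comm stable
proof (induction F)
  case empty
  then show ?case using w0 by auto
next
  case (insert M F)
  obtain w where w: "w \<in> K" "w \<noteq> 0\<^sub>v n" and eig: "\<forall>N\<in>F. \<exists>c\<in>{1,-1}. N *\<^sub>v w = c \<cdot>\<^sub>v w"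
    using insert by auto
  have wc: "w \<in> carrier_vec n" using w K by auto
  have M: "M \<in> carrier_mat n n" using insert by auto
  have Mw: "M *\<^sub>v w \<in> carrier_vec n" using M wc by simp
  show ?case
  proof (cases "w + M *\<^sub>v w = 0\<^sub>v n")
    case True
    have "M *\<^sub>v w = (-1) \<cdot>\<^sub>v w"
    proof (rule eq_vecI)
      fix i assume "i < dim_vec ((-1) \<cdot>\<^sub>v w)"
      then have i: "i < n" using wc by simp
      have "w $ i + (M *\<^sub>v w) $ i = (w + M *\<^sub>v w) $ i"
        using i M by (simp del: index_mult_mat_vec)
      then have "w $ i + (M *\<^sub>v w) $ i = 0" using True i by simp
      then show "(M *\<^sub>v w) $ i = ((-1) \<cdot>\<^sub>v w) $ i"
        using i wc M by (simp add: eq_neg_iff_add_eq_0 add.commute del: index_mult_mat_vec)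
    qed (use wc M in auto)
    then show ?thesis using w eig by (intro bexI[of _ w]) auto
  next
    case False
    define w' where "w' = w + M *\<^sub>v w"
    have "M *\<^sub>v w' = M *\<^sub>v w + (M * M) *\<^sub>v w"
      using M wc Mw by (simp add: w'_def mult_add_distrib_mat_vec)
    also have "\<dots> = w'" using insert.prems(2)[of M] wc Mw by (simp add: w'_def comm_add_vec)
    finally have "M *\<^sub>v w' = w'" .
    moreover have "\<exists>c\<in>{1,-1}. N *\<^sub>v w' = c \<cdot>\<^sub>v w'" if NF: "N \<in> F" for N
    proof -
      obtain c where c: "c \<in> {1,-1}" "N *\<^sub>v w = c \<cdot>\<^sub>v w" using eig NF by blast
      have N: "N \<in> carrier_mat n n" using insert.prems NF by auto
      have "N *\<^sub>v w' = N *\<^sub>v w + (N * M) *\<^sub>v w"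
        using M N wc Mw by (simp add: w'_def mult_add_distrib_mat_vec)
      also have "N * M = M * N" using insert.prems(3)[of N M] NF by simp
      also have "N *\<^sub>v w + (M * N) *\<^sub>v w = c \<cdot>\<^sub>v w + c \<cdot>\<^sub>v (M *\<^sub>v w)"
        using M N wc c by (simp add: mult_mat_vec)
      also have "\<dots> = c \<cdot>\<^sub>v w'" using wc Mw by (simp add: w'_def smult_add_distrib_vec)
      finally show ?thesis using c by blast
    qed
    moreover have "w' \<in> K" using add w insert.prems(4) by (simp add: w'_def)
    moreover have "w' \<in> carrier_vec n" using wc Mw by (simp add: w'_def)
    ultimately show ?thesis using False by (intro bexI[of _ w']) (auto simp: w'_def)
  qed
qed

text \<open>
  A common eigenvector spans an invariant line, and its inclusion intertwines the representation
  with one of degree one.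
\<close>

lemma Irr_degree_one_of_exponent_two:
  assumes "comm_group H" "finite (carrier H)"
    and sq: "\<And>h. h \<in> carrier H \<Longrightarrow> h \<otimes>\<^bsub>H\<^esub> h = \<one>\<^bsub>H\<^esub>"
    and "\<psi> \<in> Irr H"
  shows "\<psi> \<one>\<^bsub>H\<^esub> = 1"
proof -
  interpret comm_group H by fact
  obtain n \<rho> where irr: "irreducible_representation H n \<rho>"
    and \<psi>: "\<psi> = (\<lambda>g\<in>carrier H. mat_trace (\<rho> g))"
    using assms(4) by (auto simp: Irr_def)
  have rep: "representation H n \<rho>" and n: "n \<noteq> 0"
    using irr by (auto simp: irreducible_representation_def)
  note car = representation_carrier[OF rep]
  have one: "\<rho> \<one>\<^bsub>H\<^esub> = 1\<^sub>m n" by (rule representation_one[OF is_group rep])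
  have "unit_vec n 0 $ 0 \<noteq> (0\<^sub>v n :: complex vec) $ 0" using n by simp
  then have nz: "unit_vec n 0 \<noteq> (0\<^sub>v n :: complex vec)" by metis
  have "\<exists>w\<in>carrier_vec n. w \<noteq> 0\<^sub>v n \<and> (\<forall>M\<in>\<rho> ` carrier H. \<exists>c\<in>{1,-1}. M *\<^sub>v w = c \<cdot>\<^sub>v w)"
  proof (rule commuting_involutions_common_eigenvector)
    fix M N assume "M \<in> \<rho> ` carrier H" "N \<in> \<rho> ` carrier H"
    then show "M * N = N * M"
      using representation_mult[OF rep] by (auto simp: m_comm simp flip: representation_mult[OF rep])
  next
    fix M assume "M \<in> \<rho> ` carrier H"
    then show "M * M = 1\<^sub>m n"
      using sq one by (auto simp flip: representation_mult[OF rep])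
  qed (use assms car nz in \<open>auto intro!: mult_mat_vec_carrier\<close>)
  then obtain w where w: "w \<in> carrier_vec n" "w \<noteq> 0\<^sub>v n"
    and "\<forall>h\<in>carrier H. \<exists>c. \<rho> h *\<^sub>v w = c \<cdot>\<^sub>v w" by fast
  then obtain c where c: "\<And>h. h \<in> carrier H \<Longrightarrow> \<rho> h *\<^sub>v w = c h \<cdot>\<^sub>v w" by metis
  define M where "M = mat n 1 (\<lambda>(i,j). w $ i)"
  have M: "M \<in> carrier_mat n 1" by (simp add: M_def)
  have Mx: "M *\<^sub>v x = x $ 0 \<cdot>\<^sub>v w" if "x \<in> carrier_vec 1" for x
    using that w by (intro eq_vecI) (auto simp: M_def scalar_prod_def)
  have "mat_trace (\<rho> h) = mat_trace (c h \<cdot>\<^sub>m 1\<^sub>m 1)" if "h \<in> carrier H" for h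
    using irr M _ _ _ _ that
  proof (rule irreducible_trace_eq_intertwined)
    fix g assume g: "g \<in> carrier H"
    show "\<rho> g * M = M * (c g \<cdot>\<^sub>m 1\<^sub>m 1)"
    proof (rule mat_eqI_mult_vec)
      fix x :: "complex vec" assume x: "x \<in> carrier_vec 1"
      have "\<rho> g * M *\<^sub>v x = x $ 0 \<cdot>\<^sub>v (c g \<cdot>\<^sub>v w)"
        using car[OF g] M x w c[OF g] by (simp add: Mx mult_mat_vec)
      also have "\<dots> = (c g * x $ 0) \<cdot>\<^sub>v w" by (simp add: smult_smult_assoc mult.commute)
      also have "\<dots> = M *\<^sub>v (c g \<cdot>\<^sub>v x)" using x by (simp add: Mx)
      also have "\<dots> = M * (c g \<cdot>\<^sub>m 1\<^sub>m 1) *\<^sub>v x"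
      proof -
        have "(c g \<cdot>\<^sub>m 1\<^sub>m 1) *\<^sub>v x = c g \<cdot>\<^sub>v x"
          using x by (intro eq_vecI) (auto simp: scalar_prod_def)
        moreover have "M * (c g \<cdot>\<^sub>m 1\<^sub>m 1) *\<^sub>v x = M *\<^sub>v ((c g \<cdot>\<^sub>m 1\<^sub>m 1) *\<^sub>v x)"
          by (rule assoc_mult_mat_vec[OF M _ x]) simp
        ultimately show ?thesis by metis
      qed
      finally show "\<rho> g * M *\<^sub>v x = M * (c g \<cdot>\<^sub>m 1\<^sub>m 1) *\<^sub>v x" .
    qed (use M car[OF g] in auto)
  next
    fix x :: "complex vec" assume x: "x \<in> carrier_vec 1" "M *\<^sub>v x = 0\<^sub>v n"
    obtain i where i: "i < n" "w $ i \<noteq> 0" using w by (metis carrier_vecD eq_vecI index_zero_vec)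
    have "(x $ 0 \<cdot>\<^sub>v w) $ i = 0" using x Mx i by simp
    then have "x $ 0 = 0" using i w by simp
    then show "x = 0\<^sub>v 1" using x by (intro eq_vecI) auto
  qed auto
  from this[of "\<one>\<^bsub>H\<^esub>"] have "of_nat n = c \<one>\<^bsub>H\<^esub>"
    using one by (simp add: mat_trace_def)
  moreover have "c \<one>\<^bsub>H\<^esub> = 1"
  proof -
    obtain i where i: "i < n" "w $ i \<noteq> 0" using w by (metis carrier_vecD eq_vecI index_zero_vec)
    have "w = c \<one>\<^bsub>H\<^esub> \<cdot>\<^sub>v w" using c[of "\<one>\<^bsub>H\<^esub>"] one w by simp
    then have "w $ i = (c \<one>\<^bsub>H\<^esub> \<cdot>\<^sub>v w) $ i" by simp
    then show ?thesis using i w by simp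
  qed
  ultimately show ?thesis using one by (simp add: \<psi> mat_trace_def)
qed

section \<open>The linear characters of the function group\<close>

lemma UNIV_bit: "(UNIV :: bit set) = {0, 1}"
proof -
  have "x \<in> {0, 1}" for x :: bit by (cases x) auto
  then show ?thesis by blast
qed

instance bit :: finite
  by standard (simp add: UNIV_bit)

text \<open>
  Sums of bits have to stay sums, for the additive laws to apply to them.
\<close>

declare add_bit_eq_xor [simp del]

lemma bit_add_self: "(a :: bit) + a = 0"
  by (cases a) auto

text \<open>
  This is \<open>(-1)\<^bsup>\<Sum> u(x) f(x)\<^esup>\<close>, the perfect pairing of the \<open>F\<^sub>2\<close>-space of functions with itself,
  written multiplicatively.
\<close>

definition pairing :: "('v::finite \<Rightarrow> bit) \<Rightarrow> ('v \<Rightarrow> bit) \<Rightarrow> complex" where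
  "pairing u f = (\<Prod>x\<in>UNIV. if u x = 1 \<and> f x = 1 then -1 else 1)"

lemma pairing_commute: "pairing u f = pairing f u"
  by (simp add: pairing_def conj_commute)

lemma pairing_zero [simp]: "pairing u (\<lambda>_. 0) = 1"
  by (simp add: pairing_def)

lemma pairing_add_right: "pairing u (\<lambda>x. f x + g x) = pairing u f * pairing u g"
proof -
  have "(if a = 1 \<and> b + c = 1 then -1 else 1) =
      (if a = 1 \<and> b = 1 then -1 else 1) * (if a = 1 \<and> c = 1 then -1 else (1::complex))" for a b c :: bit
    by (cases b; cases c) auto
  then show ?thesis unfolding pairing_def prod.distrib[symmetric] by (simp only:)
qed

lemma pairing_add_left: "pairing (\<lambda>x. u x + u' x) f = pairing u f * pairing u' f"
  by (simp add: pairing_commute[of _ f] pairing_add_right)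

lemma pairing_square: "pairing u f * pairing u f = 1"
  by (simp add: bit_add_self flip: pairing_add_right)

lemma pairing_comp:
  assumes "bij p"
  shows "pairing (u \<circ> p) (f \<circ> p) = pairing u f"
  unfolding pairing_def o_def
  by (rule prod.reindex_bij_betw[OF assms])

lemma pairing_delta: "pairing u (\<lambda>y. if y = x then 1 else 0) = (if u x = 1 then -1 else 1)"
proof -
  have "pairing u (\<lambda>y. if y = x then 1 else 0) = (\<Prod>y\<in>UNIV. if y = x then (if u x = 1 then -1 else 1) else 1)"
    unfolding pairing_def by (intro prod.cong) auto
  also have "\<dots> = (if u x = 1 then -1 else 1)"
    by (subst prod.delta) auto
  finally show ?thesis .
qed

text \<open>
  The product of the two factors is \<open>pairing h f\<close> for \<open>h = u + u'\<close>.  If \<open>h x = 1\<close>, then changing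
  \<open>f\<close> at \<open>x\<close> changes the sign of every summand.
\<close>

lemma pairing_orthogonality:
  fixes u u' :: "'v::finite \<Rightarrow> bit"
  shows "(\<Sum>f\<in>UNIV. pairing u f * pairing u' f) =
     (if u = u' then of_nat (card (UNIV :: ('v \<Rightarrow> bit) set)) else 0)"
proof (cases "u = u'")
  case True
  then show ?thesis by (simp add: pairing_square)
next
  case False
  then obtain x where x: "u x \<noteq> u' x" by auto
  define h where "h = (\<lambda>x. u x + u' x)"
  have hx: "h x = 1" using x unfolding h_def by (cases "u x"; cases "u' x") auto
  define d :: "'v \<Rightarrow> bit" where "d = (\<lambda>y. if y = x then 1 else 0)"
  have "bij (\<lambda>f y. f y + d y)"
    by (rule o_bij[where g = "\<lambda>f y. f y + d y"]) (auto simp: fun_eq_iff add.assoc bit_add_self)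
  from sum.reindex_bij_betw[OF this, of "pairing h"]
  have "(\<Sum>f\<in>UNIV. pairing h f) = (\<Sum>f\<in>UNIV. pairing h (\<lambda>y. f y + d y))" by simp
  also have "\<dots> = - (\<Sum>f\<in>UNIV. pairing h f)"
    using pairing_delta[of h x] hx by (simp add: pairing_add_right d_def sum_negf)
  finally have "(\<Sum>f\<in>UNIV. pairing h f) = 0" by simp
  then show ?thesis using False by (simp add: h_def pairing_add_left)
qed

text \<open>
  A function to \<open>F\<^sub>2\<close> is the sum of the point functions of its support, so a sign character is
  determined by its values on point functions; \<open>u\<close> records these.
\<close>

lemma sign_character_eq_pairing:
  fixes \<epsilon> :: "('v::finite \<Rightarrow> bit) \<Rightarrow> complex"
  assumes sign: "\<And>f. \<epsilon> f \<in> {1, -1}"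
    and mult: "\<And>f g. \<epsilon> (\<lambda>x. f x + g x) = \<epsilon> f * \<epsilon> g"
  obtains u where "\<epsilon> = pairing u"
proof
  define u :: "'v \<Rightarrow> bit" where
    "u = (\<lambda>x. if \<epsilon> (\<lambda>y. if y = x then 1 else 0) = -1 then 1 else 0)"
  show "\<epsilon> = pairing u"
  proof
    fix f
    have "\<epsilon> (\<lambda>y. if y \<in> X then f y else 0) = (\<Prod>x\<in>X. if u x = 1 \<and> f x = 1 then -1 else 1)"
      if "finite X" for X
      using that
    proof (induction X)
      case empty
      have "\<epsilon> (\<lambda>_. 0) = \<epsilon> (\<lambda>_. 0) * \<epsilon> (\<lambda>_. 0)" using mult[of "\<lambda>_. 0" "\<lambda>_. 0"] by simp
      then have "\<epsilon> (\<lambda>_. 0) = 1" using sign[of "\<lambda>_. 0"] by auto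
      then show ?case by simp
    next
      case (insert x X)
      have "(\<lambda>y. if y \<in> insert x X then f y else 0) =
          (\<lambda>y. (if y \<in> X then f y else 0) + (if y = x then f x else 0))"
        using insert.hyps by auto
      then have "\<epsilon> (\<lambda>y. if y \<in> insert x X then f y else 0) =
          \<epsilon> (\<lambda>y. if y \<in> X then f y else 0) * \<epsilon> (\<lambda>y. if y = x then f x else 0)"
        using mult[of "\<lambda>y. if y \<in> X then f y else 0" "\<lambda>y. if y = x then f x else 0"] by simp
      moreover have "\<epsilon> (\<lambda>y. if y = x then f x else 0) = (if u x = 1 \<and> f x = 1 then -1 else 1)"
      proof (cases "f x")
        case zero
        have "\<epsilon> (\<lambda>_. 0) = \<epsilon> (\<lambda>_. 0) * \<epsilon> (\<lambda>_. 0)" using mult[of "\<lambda>_. 0" "\<lambda>_. 0"] by simp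
        then have "\<epsilon> (\<lambda>_. 0) = 1" using sign[of "\<lambda>_. 0"] by auto
        then show ?thesis using zero by (simp cong: if_cong)
      next
        case one
        then show ?thesis using sign[of "\<lambda>y. if y = x then 1 else 0"] by (auto simp: u_def cong: if_cong)
      qed
      ultimately show ?case using insert by simp
    qed
    from this[of UNIV] show "\<epsilon> f = pairing u f" by (simp add: pairing_def)
  qed
qed

section \<open>Translation orbits and their characters\<close>

definition translate :: "'v::ab_group_add \<Rightarrow> ('v \<Rightarrow> bit) \<Rightarrow> 'v \<Rightarrow> bit" where
  "translate t u = (\<lambda>x. u (x + t))"

definition translates :: "('v::ab_group_add \<Rightarrow> bit) \<Rightarrow> ('v \<Rightarrow> bit) set" where
  "translates u = range (\<lambda>t. translate t u)"

text \<open>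
  The character of \<open>G\<close> induced from \<open>B \<rtimes> T\<close>, where \<open>T\<close> is the stabilizer of \<open>u\<close> in \<open>V\<close>, by the
  extension of \<open>pairing u\<close> that is trivial on \<open>T\<close>.
\<close>

definition orbit_character :: "('v::{ab_group_add,finite} \<Rightarrow> bit) \<Rightarrow> ('v \<Rightarrow> bit) \<times> 'v \<Rightarrow> complex" where
  "orbit_character u = (\<lambda>(f, t). if translate t u = u then \<Sum>u'\<in>translates u. pairing u' f else 0)"

lemma translate_zero [simp]: "translate 0 u = u"
  by (simp add: translate_def)

lemma translate_translate: "translate s (translate t u) = translate (s + t) u"
  by (simp add: translate_def add.assoc)

lemma self_mem_translates: "u \<in> translates u"
  using rangeI[of "\<lambda>t. translate t u" 0] by (simp add: translates_def)

lemma translate_mem_translates: "u' \<in> translates u \<Longrightarrow> translate t u' \<in> translates u"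
  unfolding translates_def by (auto simp: translate_translate)

lemma translate_stabilizes_translates_iff:
  assumes "u' \<in> translates u"
  shows "translate t u' = u' \<longleftrightarrow> translate t u = u"
proof -
  obtain s where u': "u' = translate s u" using assms by (auto simp: translates_def)
  have "translate (-s) (translate t u') = translate t u" "translate (-s) u' = u"
    by (simp_all add: u' translate_translate)
  moreover have "translate t u' = translate s (translate t u)"
    by (simp add: u' translate_translate add.commute)
  ultimately show ?thesis using u' by auto
qed

lemma translates_eq:
  assumes "u' \<in> translates u"
  shows "translates u' = translates u"
proof -
  obtain s where u': "u' = translate s u" using assms by (auto simp: translates_def)
  have "u = translate (- s) u'" by (simp add: u' translate_translate)
  then have "u \<in> translates u'" unfolding translates_def by (rule range_eqI)
  then show ?thesis
    using translate_mem_translates[OF assms] translate_mem_translates[of u u']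
    by (auto simp: translates_def[of u] translates_def[of u'])
qed

lemma orbit_character_translates:
  assumes "u' \<in> translates u"
  shows "orbit_character u' = orbit_character u"
  using translates_eq[OF assms] translate_stabilizes_translates_iff[OF assms]
  by (auto simp: orbit_character_def fun_eq_iff)

lemma pairing_translate_translate:
  "pairing (translate t u) (translate t f) = pairing u (f :: 'v::{ab_group_add,finite} \<Rightarrow> bit)"
proof -
  have "bij (\<lambda>x::'v. x + t)" by (rule o_bij[where g = "\<lambda>x. x - t"]) auto
  then show ?thesis using pairing_comp[of "\<lambda>x. x + t" u f] by (simp add: translate_def o_def)
qed

text \<open>
  Fourier inversion on \<open>B\<close>: the orbit and the stabilizer of \<open>u\<close> can be recovered from the
  character.
\<close>

lemma sum_pairing_orbit_character:
  fixes u u' :: "'v::{ab_group_add,finite} \<Rightarrow> bit"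
  shows "(\<Sum>f\<in>UNIV. pairing u' f * orbit_character u (f, t)) =
    (if translate t u = u \<and> u' \<in> translates u
     then of_nat (card (UNIV :: ('v \<Rightarrow> bit) set)) else 0)"
proof (cases "translate t u = u")
  case True
  have "(\<Sum>f\<in>UNIV. pairing u' f * orbit_character u (f, t)) =
      (\<Sum>u''\<in>translates u. \<Sum>f\<in>UNIV. pairing u' f * pairing u'' f)"
    using True by (subst sum.swap) (simp add: orbit_character_def sum_distrib_left)
  then show ?thesis using True by (simp add: pairing_orthogonality)
qed (simp add: orbit_character_def)

section \<open>The irreducible characters of the semidirect product\<close>

lemma group_function_semidirect: "group (function_semidirect :: (('v::ab_group_add \<Rightarrow> bit) \<times> 'v) monoid)"
proof (rule groupI)
  fix x :: "('v \<Rightarrow> bit) \<times> 'v"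
  obtain f t where x: "x = (f, t)" by (cases x)
  show "\<exists>y\<in>carrier function_semidirect. y \<otimes>\<^bsub>function_semidirect\<^esub> x = \<one>\<^bsub>function_semidirect\<^esub>"
    by (rule bexI[of _ "(translate (- t) f, - t)"])
       (auto simp: function_semidirect_def x translate_def bit_add_self)
qed (auto simp: function_semidirect_def add.assoc)

text \<open>
  The representation has a basis indexed by the translates of \<open>u\<close>, on which \<open>B\<close> acts diagonally
  with pairwise different characters and \<open>V\<close> acts by a transitive permutation.  An invariant
  subspace contains, along with a vector, its projections onto the weight spaces of \<open>B\<close>, hence
  some basis vector, and by transitivity all of them.
\<close>

lemma orbit_character_in_Irr:
  fixes u :: "'v::{ab_group_add,finite} \<Rightarrow> bit"
  shows "orbit_character u \<in> Irr function_semidirect"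
proof -
  define m where "m = card (translates u)"
  obtain e where e: "bij_betw e {..<m} (translates u)"
    unfolding m_def using ex_bij_betw_nat_finite[of "translates u"] by (auto simp: atLeast0LessThan)
  have e_inj: "e i = e j \<longleftrightarrow> i = j" if "i < m" "j < m" for i j
    using e that by (auto simp: bij_betw_def inj_on_def)
  have e_mem: "e i \<in> translates u" if "i < m" for i
    using e that by (auto simp: bij_betw_def)
  have e_surj: "\<exists>i<m. e i = u'" if "u' \<in> translates u" for u'
    using bij_betw_imp_surj_on[OF e] that by (metis imageE lessThan_iff)
  define \<sigma> where "\<sigma> = (\<lambda>(f, t). mat m m (\<lambda>(i, j).
      if e i = translate t (e j) then pairing (e i) f else 0))"
  have \<sigma>: "\<sigma> g \<in> carrier_mat m m" for g by (cases g) (simp add: \<sigma>_def)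
  have rep: "representation function_semidirect m \<sigma>"
  proof (rule representationI[OF group_function_semidirect \<sigma>])
    show "\<sigma> \<one>\<^bsub>function_semidirect\<^esub> = 1\<^sub>m m"
      by (rule eq_matI) (auto simp: \<sigma>_def function_semidirect_def e_inj)
  next
    fix g h :: "('v \<Rightarrow> bit) \<times> 'v"
    obtain f t where g: "g = (f, t)" by (cases g)
    obtain f' s where h: "h = (f', s)" by (cases h)
    have gh: "g \<otimes>\<^bsub>function_semidirect\<^esub> h = ((\<lambda>x. f x + translate t f' x), t + s)"
      by (simp add: g h function_semidirect_def translate_def)
    show "\<sigma> (g \<otimes>\<^bsub>function_semidirect\<^esub> h) = \<sigma> g * \<sigma> h"
    proof (rule eq_matI)
      fix i k assume "i < dim_row (\<sigma> g * \<sigma> h)" "k < dim_col (\<sigma> g * \<sigma> h)"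
      then have i: "i < m" and k: "k < m" using \<sigma>[of g] \<sigma>[of h] by auto
      obtain j where j: "j < m" "e j = translate s (e k)"
        using e_surj[OF translate_mem_translates[OF e_mem[OF k]]] by blast
      have off_j: "\<sigma> h $$ (j', k) = 0" if "j' < m" "j' \<noteq> j" for j'
        using that k j e_inj[of j' j] by (auto simp: \<sigma>_def h)
      have "(\<sigma> g * \<sigma> h) $$ (i, k) = (\<Sum>j'<m. \<sigma> g $$ (i, j') * \<sigma> h $$ (j', k))"
        using i k \<sigma>[of g] \<sigma>[of h] by (simp add: scalar_prod_def atLeast0LessThan)
      also have "\<dots> = (\<Sum>j'<m. if j' = j then \<sigma> g $$ (i, j) * \<sigma> h $$ (j, k) else 0)"
        using off_j by (intro sum.cong) auto
      also have "\<dots> = \<sigma> g $$ (i, j) * \<sigma> h $$ (j, k)" using j by simp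
      also have "\<dots> = \<sigma> (g \<otimes>\<^bsub>function_semidirect\<^esub> h) $$ (i, k)"
        unfolding gh using i j k pairing_translate_translate[of t "translate s (e k)" f']
        by (auto simp: \<sigma>_def g h translate_translate pairing_add_right)
      finally show "\<sigma> (g \<otimes>\<^bsub>function_semidirect\<^esub> h) $$ (i, k) = (\<sigma> g * \<sigma> h) $$ (i, k)" ..
    qed (use \<sigma>[of g] \<sigma>[of h] \<sigma>[of "g \<otimes>\<^bsub>function_semidirect\<^esub> h"] in auto)
  qed
  have "m \<noteq> 0" unfolding m_def using self_mem_translates[of u] by auto
  moreover have "W = {0\<^sub>v m} \<or> W = carrier_vec m"
    if W: "VectorSpace.subspace class_ring W (module_vec TYPE(complex) m)"
      and stable: "\<forall>g\<in>carrier function_semidirect. \<forall>w\<in>W. \<sigma> g *\<^sub>v w \<in> W" for W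
  proof (rule disjCI)
    assume "W \<noteq> carrier_vec m"
    have smult: "c \<cdot>\<^sub>v w \<in> W" if "w \<in> W" for c w
      using W that by (simp add: subspace_iff_closed)
    have \<sigma>W: "\<sigma> g *\<^sub>v w \<in> W" if "w \<in> W" for g w
      using stable that by (cases g) (simp add: function_semidirect_def)
    have unit_all: "W = carrier_vec m" if w: "w \<in> W" and j: "j < m" and wj: "w $ j \<noteq> 0" for w j
    proof -
      have wc: "w \<in> carrier_vec m" using W w by (auto simp: subspace_iff_closed)
      define N :: complex where "N = of_nat (card (UNIV :: ('v \<Rightarrow> bit) set))"
      have N: "N \<noteq> 0" by (simp add: N_def)
      have act: "(\<sigma> (f, 0) *\<^sub>v w) $ i = pairing (e i) f * w $ i" if i: "i < m" for i f
      proof -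
        have "(\<sigma> (f, 0) *\<^sub>v w) $ i = (\<Sum>k<m. (if e i = e k then pairing (e i) f else 0) * w $ k)"
          using i wc by (simp add: \<sigma>_def scalar_prod_def atLeast0LessThan)
        also have "\<dots> = (\<Sum>k<m. if k = i then pairing (e i) f * w $ i else 0)"
          using i e_inj by (intro sum.cong) auto
        finally show ?thesis using i by simp
      qed
      \<comment> \<open>By orthogonality this combination is the projection of \<open>w\<close> onto the \<open>j\<close>-th basis vector,
        scaled by the order of \<open>B\<close>.\<close>
      have "vec m (\<lambda>i. \<Sum>f\<in>UNIV. (pairing (e j) f \<cdot>\<^sub>v (\<sigma> (f, 0) *\<^sub>v w)) $ i) \<in> W"
        using w by (intro subspace_closed_sum[OF W] smult \<sigma>W) auto
      also have "vec m (\<lambda>i. \<Sum>f\<in>UNIV. (pairing (e j) f \<cdot>\<^sub>v (\<sigma> (f, 0) *\<^sub>v w)) $ i) =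
          (N * w $ j) \<cdot>\<^sub>v unit_vec m j"
      proof (rule eq_vecI)
        fix i assume "i < dim_vec ((N * w $ j) \<cdot>\<^sub>v unit_vec m j)"
        then have i: "i < m" by simp
        have "(\<Sum>f\<in>UNIV. (pairing (e j) f \<cdot>\<^sub>v (\<sigma> (f, 0) *\<^sub>v w)) $ i) =
            (\<Sum>f\<in>UNIV. pairing (e j) f * (pairing (e i) f * w $ i))"
          using i act carrier_matD(1)[OF \<sigma>] by (intro sum.cong) (auto simp del: index_mult_mat_vec)
        also have "\<dots> = (\<Sum>f\<in>UNIV. pairing (e j) f * pairing (e i) f) * w $ i"
          by (simp add: sum_distrib_right mult.assoc)
        also have "\<dots> = ((N * w $ j) \<cdot>\<^sub>v unit_vec m j) $ i"
          using i j by (auto simp: pairing_orthogonality e_inj N_def)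
        finally show "vec m (\<lambda>i. \<Sum>f\<in>UNIV. (pairing (e j) f \<cdot>\<^sub>v (\<sigma> (f, 0) *\<^sub>v w)) $ i) $ i =
            ((N * w $ j) \<cdot>\<^sub>v unit_vec m j) $ i" using i by simp
      qed simp
      finally have "inverse (N * w $ j) \<cdot>\<^sub>v ((N * w $ j) \<cdot>\<^sub>v unit_vec m j) \<in> W" by (rule smult)
      moreover have "inverse (N * w $ j) * (N * w $ j) = 1"
        using N wj by (intro left_inverse) simp
      ultimately have unit_j: "unit_vec m j \<in> W" unfolding smult_smult_assoc by (simp only: one_smult_vec)
      have unit: "unit_vec m k \<in> W" if k: "k < m" for k
      proof -
        obtain s where s: "e k = translate s u" using e_mem[OF k] by (auto simp: translates_def)
        obtain r where r: "e j = translate r u" using e_mem[OF j] by (auto simp: translates_def)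
        have ek: "e k = translate (s - r) (e j)" by (simp add: r s translate_translate)
        have "\<sigma> (\<lambda>_. 0, s - r) *\<^sub>v unit_vec m j = unit_vec m k"
          using j k e_inj by (subst mult_unit_vec_eq_col[OF \<sigma>]) (auto simp: \<sigma>_def ek[symmetric] intro!: eq_vecI)
        then show ?thesis using \<sigma>W[OF unit_j] by metis
      qed
      have "x \<in> W" if x: "x \<in> carrier_vec m" for x
      proof -
        have "vec m (\<lambda>i. \<Sum>k\<in>{..<m}. (x $ k \<cdot>\<^sub>v unit_vec m k) $ i) \<in> W"
          by (intro subspace_closed_sum[OF W] smult unit) auto
        also have "vec m (\<lambda>i. \<Sum>k\<in>{..<m}. (x $ k \<cdot>\<^sub>v unit_vec m k) $ i) = x"
        proof (rule eq_vecI)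
          fix i assume "i < dim_vec x"
          then have i: "i < m" using x by simp
          have "(\<Sum>k<m. (x $ k \<cdot>\<^sub>v unit_vec m k) $ i) = (\<Sum>k<m. if k = i then x $ i else 0)"
            using i by (intro sum.cong) auto
          then show "vec m (\<lambda>i. \<Sum>k\<in>{..<m}. (x $ k \<cdot>\<^sub>v unit_vec m k) $ i) $ i = x $ i"
            using i by simp
        qed (use x in simp)
        finally show ?thesis .
      qed
      then show ?thesis using W by (auto simp: subspace_iff_closed)
    qed
    have "w = 0\<^sub>v m" if "w \<in> W" for w
    proof (rule eq_vecI)
      fix i assume "i < dim_vec (0\<^sub>v m :: complex vec)"
      then show "w $ i = 0\<^sub>v m $ i" using unit_all[OF that, of i] \<open>W \<noteq> carrier_vec m\<close> by auto
    qed (use W that in \<open>auto simp: subspace_iff_closed\<close>)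
    then show "W = {0\<^sub>v m}" using W by (auto simp: subspace_iff_closed)
  qed
  ultimately have irr: "irreducible_representation function_semidirect m \<sigma>"
    unfolding irreducible_representation_def using rep by blast
  have "mat_trace (\<sigma> (f, t)) = orbit_character u (f, t)" for f t
  proof -
    have "mat_trace (\<sigma> (f, t)) = (\<Sum>i<m. if translate t u = u then pairing (e i) f else 0)"
      unfolding mat_trace_def \<sigma>_def
      using translate_stabilizes_translates_iff[OF e_mem]
      by (intro sum.cong) (auto simp: eq_commute[of "e _"])
    also have "\<dots> = orbit_character u (f, t)"
      using sum.reindex_bij_betw[OF e, of "\<lambda>u'. pairing u' f"] by (simp add: orbit_character_def)
    finally show ?thesis .
  qed
  then have "orbit_character u = (\<lambda>g\<in>carrier function_semidirect. mat_trace (\<sigma> g))"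
    by (auto simp: function_semidirect_def)
  then show ?thesis using irr unfolding Irr_def by blast
qed

text \<open>
  A nonzero weight vector for \<open>B\<close> can be chosen, within its weight space, to be an eigenvector of
  the stabilizer \<open>T\<close> as well.  Its images under representatives of the cosets of \<open>T\<close> in \<open>V\<close> have
  pairwise different weights, so they are linearly independent, and they are permuted by \<open>G\<close> up to
  scalars.  In this basis the trace is visible.
\<close>

lemma irreducible_character_eq_twisted_orbit_character:
  fixes \<rho> :: "('v::{ab_group_add,finite} \<Rightarrow> bit) \<times> 'v \<Rightarrow> complex mat"
  assumes add_self_zero: "\<And>t :: 'v. t + t = 0"
    and irr: "irreducible_representation function_semidirect n \<rho>"
  obtains u \<mu> where
    "\<And>t. translate t u = u \<Longrightarrow> \<mu> t \<in> {1, -1}"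
    "\<And>s t. translate s u = u \<Longrightarrow> translate t u = u \<Longrightarrow> \<mu> (s + t) = \<mu> s * \<mu> t"
    "\<And>f t. mat_trace (\<rho> (f, t)) = \<mu> t * orbit_character u (f, t)"
proof -
  have rep: "representation function_semidirect n \<rho>" and n: "n \<noteq> 0"
    using irr by (auto simp: irreducible_representation_def)
  have car [simp]: "\<rho> g \<in> carrier_mat n n" for g
    using representation_carrier[OF rep, of g] by (simp add: function_semidirect_def)
  have mult: "\<rho> (f, t) * \<rho> (g, s) = \<rho> (\<lambda>x. f x + translate t g x, t + s)" for f g t s
    using representation_mult[OF rep, of "(f, t)" "(g, s)"]
    by (simp add: function_semidirect_def translate_def)
  have one: "\<rho> (\<lambda>_. 0, 0) = 1\<^sub>m n"
    using representation_one[OF group_function_semidirect rep] by (simp add: function_semidirect_def)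
  define b where "b f = \<rho> (f, 0)" for f
  define v where "v t = \<rho> (\<lambda>_. 0, t)" for t
  have [simp]: "b f \<in> carrier_mat n n" "v t \<in> carrier_mat n n" for f t by (simp_all add: b_def v_def)
  have zero_t: "translate t (\<lambda>_. 0) = (\<lambda>_. 0)" for t :: 'v by (simp add: translate_def)
  have bb: "b f * b g = b (\<lambda>x. f x + g x)" for f g by (simp add: b_def mult)
  have vv: "v s * v t = v (s + t)" for s t by (simp add: v_def mult zero_t)
  have bv: "\<rho> (f, t) = b f * v t" for f t by (simp add: b_def v_def mult)
  have vb: "v t * b f = b (translate t f) * v t" for t f by (simp add: b_def v_def mult zero_t)
  have v0: "v 0 = 1\<^sub>m n" by (simp add: v_def one)
  have b0: "b (\<lambda>_. 0) = 1\<^sub>m n" by (simp add: b_def one)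
  have tt: "translate t (translate t f) = f" for t :: 'v and f
    by (simp add: translate_translate add_self_zero)
  have eig_unique: "c = d" if w: "w \<in> carrier_vec n" "w \<noteq> 0\<^sub>v n" and eq: "c \<cdot>\<^sub>v w = d \<cdot>\<^sub>v w" for c d :: complex and w
  proof -
    obtain i where i: "i < n" "w $ i \<noteq> 0" using w by (metis carrier_vecD eq_vecI index_zero_vec)
    have "(c \<cdot>\<^sub>v w) $ i = (d \<cdot>\<^sub>v w) $ i" using eq by simp
    then show ?thesis using i w(1) by simp
  qed

  have "\<exists>w\<in>carrier_vec n. w \<noteq> 0\<^sub>v n \<and> (\<forall>M\<in>range b. \<exists>c\<in>{1,-1}. M *\<^sub>v w = c \<cdot>\<^sub>v w)"
  proof (rule commuting_involutions_common_eigenvector)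
    show "unit_vec n 0 \<noteq> (0\<^sub>v n :: complex vec)" using n by simp
    fix M N assume "M \<in> range b" "N \<in> range b"
    then show "M * N = N * M" by (auto simp: bb add.commute)
  next
    fix M assume "M \<in> range b"
    then show "M * M = 1\<^sub>m n" by (auto simp: bb bit_add_self b0)
  next
    fix M :: "complex mat" and x :: "complex vec" assume "M \<in> range b" "x \<in> carrier_vec n"
    then show "M *\<^sub>v x \<in> carrier_vec n" by (auto intro!: mult_mat_vec_carrier)
  qed auto
  then obtain w\<^sub>0 where w0: "w\<^sub>0 \<in> carrier_vec n" "w\<^sub>0 \<noteq> 0\<^sub>v n"
    and eig0: "\<forall>M\<in>range b. \<exists>c\<in>{1,-1}. M *\<^sub>v w\<^sub>0 = c \<cdot>\<^sub>v w\<^sub>0" by auto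
  have "\<exists>c. c \<in> {1,-1} \<and> b f *\<^sub>v w\<^sub>0 = c \<cdot>\<^sub>v w\<^sub>0" for f
    using bspec[OF eig0 rangeI[of b f]] by auto
  then obtain \<epsilon> where \<epsilon>: "\<And>f. \<epsilon> f \<in> {1,-1}" "\<And>f. b f *\<^sub>v w\<^sub>0 = \<epsilon> f \<cdot>\<^sub>v w\<^sub>0" by metis
  have "\<epsilon> (\<lambda>x. f x + g x) = \<epsilon> f * \<epsilon> g" for f g
  proof (rule eig_unique[OF w0])
    have "\<epsilon> (\<lambda>x. f x + g x) \<cdot>\<^sub>v w\<^sub>0 = (b f * b g) *\<^sub>v w\<^sub>0" by (simp add: bb \<epsilon>)
    also have "\<dots> = b f *\<^sub>v (b g *\<^sub>v w\<^sub>0)" using w0 by (intro assoc_mult_mat_vec[of _ n n _ n]) auto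
    also have "\<dots> = \<epsilon> g \<cdot>\<^sub>v (\<epsilon> f \<cdot>\<^sub>v w\<^sub>0)"
      unfolding \<epsilon>(2)[of g] using w0 by (subst mult_mat_vec[of _ n n]) (auto simp: \<epsilon>)
    also have "\<dots> = (\<epsilon> f * \<epsilon> g) \<cdot>\<^sub>v w\<^sub>0" by (simp add: smult_smult_assoc mult.commute)
    finally show "\<epsilon> (\<lambda>x. f x + g x) \<cdot>\<^sub>v w\<^sub>0 = (\<epsilon> f * \<epsilon> g) \<cdot>\<^sub>v w\<^sub>0" .
  qed
  with \<epsilon>(1) obtain u where "\<epsilon> = pairing u" by (rule sign_character_eq_pairing)
  with \<epsilon>(2) have u: "b f *\<^sub>v w\<^sub>0 = pairing u f \<cdot>\<^sub>v w\<^sub>0" for f by simp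

  define T where "T = {t. translate t u = u}"
  have T_add: "s + t \<in> T" if "s \<in> T" "t \<in> T" for s t
    using that by (simp add: T_def flip: translate_translate)
  define K where "K = {w \<in> carrier_vec n. \<forall>f. b f *\<^sub>v w = pairing u f \<cdot>\<^sub>v w}"
  have weight: "b f *\<^sub>v (v t *\<^sub>v w) = pairing (translate t u) f \<cdot>\<^sub>v (v t *\<^sub>v w)" if w: "w \<in> K" for f t w
  proof -
    have wc: "w \<in> carrier_vec n" using w by (simp add: K_def)
    have "b f *\<^sub>v (v t *\<^sub>v w) = (b f * v t) *\<^sub>v w"
      using wc by (intro assoc_mult_mat_vec[of _ n n _ n, symmetric]) auto
    also have "b f * v t = v t * b (translate t f)" by (simp add: vb tt)
    also have "(v t * b (translate t f)) *\<^sub>v w = v t *\<^sub>v (b (translate t f) *\<^sub>v w)"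
      using wc by (intro assoc_mult_mat_vec[of _ n n _ n]) auto
    also have "\<dots> = pairing u (translate t f) \<cdot>\<^sub>v (v t *\<^sub>v w)"
      using w wc by (simp add: K_def mult_mat_vec[of _ n n])
    also have "pairing u (translate t f) = pairing (translate t u) f"
      using pairing_translate_translate[of t u "translate t f"] by (simp add: tt)
    finally show ?thesis .
  qed
  have "\<exists>w\<in>K. w \<noteq> 0\<^sub>v n \<and> (\<forall>M\<in>v ` T. \<exists>c\<in>{1,-1}. M *\<^sub>v w = c \<cdot>\<^sub>v w)"
  proof (rule commuting_involutions_common_eigenvector)
    show "w\<^sub>0 \<in> K" using w0 u by (simp add: K_def)
    show "K \<subseteq> carrier_vec n" by (auto simp: K_def)
    show "x + y \<in> K" if "x \<in> K" "y \<in> K" for x y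
      using that by (auto simp: K_def mult_add_distrib_mat_vec[of _ n n] smult_add_distrib_vec[of _ n])
    fix M N assume "M \<in> v ` T" "N \<in> v ` T"
    then show "M * N = N * M" by (auto simp: vv add.commute)
  next
    fix M assume "M \<in> v ` T"
    then show "M * M = 1\<^sub>m n" by (auto simp: vv add_self_zero v0)
  next
    fix M :: "complex mat" and x :: "complex vec" assume "M \<in> v ` T" and x: "x \<in> K"
    then obtain t where t: "M = v t" "translate t u = u" by (auto simp: T_def)
    have "x \<in> carrier_vec n" using x by (simp add: K_def)
    then have "v t *\<^sub>v x \<in> carrier_vec n" by (intro mult_mat_vec_carrier[of _ n n]) auto
    then show "M *\<^sub>v x \<in> K" using weight[OF x, of _ t] t by (simp add: K_def)
  qed (use w0 in auto)
  then obtain w where w: "w \<in> K" "w \<noteq> 0\<^sub>v n"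
    and eig: "\<forall>M\<in>v ` T. \<exists>c\<in>{1,-1}. M *\<^sub>v w = c \<cdot>\<^sub>v w" by auto
  have "\<forall>t\<in>T. \<exists>c. c \<in> {1,-1} \<and> v t *\<^sub>v w = c \<cdot>\<^sub>v w"
  proof
    fix t assume "t \<in> T"
    from bspec[OF eig imageI[OF this, of v]]
    show "\<exists>c. c \<in> {1,-1} \<and> v t *\<^sub>v w = c \<cdot>\<^sub>v w" by auto
  qed
  then obtain \<mu> where \<mu>: "\<And>t. t \<in> T \<Longrightarrow> \<mu> t \<in> {1,-1}" "\<And>t. t \<in> T \<Longrightarrow> v t *\<^sub>v w = \<mu> t \<cdot>\<^sub>v w" by metis
  have wc [simp]: "w \<in> carrier_vec n" using w by (simp add: K_def)
  have vw_c [simp]: "v t *\<^sub>v w \<in> carrier_vec n" for t by (intro mult_mat_vec_carrier[of _ n n]) auto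
  have vvw: "v s *\<^sub>v (v t *\<^sub>v w) = v (s + t) *\<^sub>v w" for s t
    by (simp add: assoc_mult_mat_vec[of _ n n _ n, symmetric] vv)
  have \<mu>_mult: "\<mu> (s + t) = \<mu> s * \<mu> t" if "s \<in> T" "t \<in> T" for s t
  proof (rule eig_unique[OF wc w(2)])
    have "\<mu> (s + t) \<cdot>\<^sub>v w = v s *\<^sub>v (\<mu> t \<cdot>\<^sub>v w)"
      using vvw[of s t] \<mu>(2)[OF T_add[OF that]] \<mu>(2)[OF that(2)] by simp
    also have "\<dots> = \<mu> t \<cdot>\<^sub>v (\<mu> s \<cdot>\<^sub>v w)"
      using \<mu>(2)[OF that(1)] by (simp add: mult_mat_vec[of _ n n])
    finally show "\<mu> (s + t) \<cdot>\<^sub>v w = (\<mu> s * \<mu> t) \<cdot>\<^sub>v w" by (simp add: smult_smult_assoc mult.commute)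
  qed

  define m where "m = card (translates u)"
  obtain e where e: "bij_betw e {..<m} (translates u)"
    unfolding m_def using ex_bij_betw_nat_finite[of "translates u"] by (auto simp: atLeast0LessThan)
  have e_inj: "e i = e j \<longleftrightarrow> i = j" if "i < m" "j < m" for i j
    using e that by (auto simp: bij_betw_def inj_on_def)
  have e_mem: "e i \<in> translates u" if "i < m" for i
    using e that by (auto simp: bij_betw_def)
  have e_surj: "\<exists>i<m. e i = u'" if "u' \<in> translates u" for u'
    using bij_betw_imp_surj_on[OF e] that by (metis imageE lessThan_iff)
  have "\<exists>r. translate r u = e i" if "i < m" for i
    using e_mem[OF that] unfolding translates_def by (metis rangeE)
  then obtain r where r: "\<And>i. i < m \<Longrightarrow> translate (r i) u = e i" by metis
  define M where "M = mat n m (\<lambda>(i, j). (v (r j) *\<^sub>v w) $ i)"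
  have M: "M \<in> carrier_mat n m" by (simp add: M_def)
  have colM: "col M j = v (r j) *\<^sub>v w" if "j < m" for j
    using that by (intro eq_vecI)
      (auto simp: M_def carrier_vecD[OF vw_c] simp del: index_mult_mat_vec dim_mult_mat_vec)
  \<comment> \<open>If \<open>t\<close> moves the \<open>j\<close>-th translate to the \<open>i\<close>-th one, then \<open>t + r j\<close> and \<open>r i\<close> lie in the same
    coset of \<open>T\<close>; their difference is their sum, and it acts on \<open>w\<close> by \<open>\<mu>\<close>.\<close>
  define S where "S = (\<lambda>(f, t). mat m m (\<lambda>(i, j).
      if e i = translate t (e j) then pairing (e i) f * \<mu> (t + r j + r i) else 0))"
  have S: "S g \<in> carrier_mat m m" for g by (cases g) (simp add: S_def)
  have twine: "\<rho> g * M = M * S g" for g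
  proof (rule mat_col_eqI)
    obtain f t where g: "g = (f, t)" by (cases g)
    fix j assume "j < dim_col (M * S g)"
    then have j: "j < m" using M S[of g] by simp
    obtain k where k: "k < m" "e k = translate t (e j)"
      using e_surj[OF translate_mem_translates[OF e_mem[OF j]]] by blast
    define s where "s = t + r j + r k"
    have "translate (r k) (translate (t + r j) u) = u"
      using k r[OF j] r[OF k(1)] tt[of "r k" u] by (simp flip: translate_translate)
    then have s: "s \<in> T" by (simp add: T_def s_def translate_translate add.commute)
    have trj: "t + r j = r k + s" using add_self_zero[of "r k"] by (simp add: s_def algebra_simps)
    have "col (\<rho> g * M) j = \<rho> g *\<^sub>v (v (r j) *\<^sub>v w)"
      using j M by (simp add: colM[symmetric] col_mult2[of _ n n _ m])
    also have "\<dots> = b f *\<^sub>v (v (t + r j) *\<^sub>v w)"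
      by (simp add: g bv assoc_mult_mat_vec[of _ n n _ n] vvw)
    also have "v (t + r j) *\<^sub>v w = \<mu> s \<cdot>\<^sub>v (v (r k) *\<^sub>v w)"
      by (simp add: trj \<mu>(2)[OF s] mult_mat_vec[of _ n n] flip: vvw)
    also have "b f *\<^sub>v (\<mu> s \<cdot>\<^sub>v (v (r k) *\<^sub>v w)) = \<mu> s \<cdot>\<^sub>v (pairing (e k) f \<cdot>\<^sub>v (v (r k) *\<^sub>v w))"
      by (simp add: mult_mat_vec[of _ n n] weight[OF w(1)] r[OF k(1)])
    also have "\<dots> = (pairing (e k) f * \<mu> s) \<cdot>\<^sub>v col M k"
      by (simp add: smult_smult_assoc colM[OF k(1)] mult.commute)
    also have "\<dots> = M *\<^sub>v ((pairing (e k) f * \<mu> s) \<cdot>\<^sub>v unit_vec m k)"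
      using M k by (simp add: mult_mat_vec[of _ n m] mult_unit_vec_eq_col[OF M])
    also have "(pairing (e k) f * \<mu> s) \<cdot>\<^sub>v unit_vec m k = col (S g) j"
      using j k e_inj by (intro eq_vecI) (auto simp: S_def g s_def k(2)[symmetric])
    also have "M *\<^sub>v col (S g) j = col (M * S g) j"
      by (rule col_mult2[OF M S[of g] j, symmetric])
    finally show "col (\<rho> g * M) j = col (M * S g) j" .
  qed (use M S[of g] carrier_matD(1)[OF car[of g]] in auto)
  have T0: "0 \<in> T" by (simp add: T_def)
  have \<mu>0: "\<mu> 0 = 1"
    using \<mu>_mult[OF T0 T0] \<mu>(1)[OF T0] by auto
  have ker: "x = 0\<^sub>v m" if x: "x \<in> carrier_vec m" and Mx: "M *\<^sub>v x = 0\<^sub>v n" for x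
  proof (rule eq_vecI)
    fix k assume "k < dim_vec (0\<^sub>v m :: complex vec)"
    then have k: "k < m" by simp
    have "v (r k) *\<^sub>v w \<noteq> 0\<^sub>v n"
    proof
      assume 0: "v (r k) *\<^sub>v w = 0\<^sub>v n"
      have "w = v (r k) *\<^sub>v (v (r k) *\<^sub>v w)" by (simp add: vvw add_self_zero v0)
      also have "\<dots> = 0\<^sub>v n" unfolding 0
        using carrier_matD(1)[of "v (r k)" n n] by (intro eq_vecI) auto
      finally show False using w by simp
    qed
    then obtain i where i: "i < n" "(v (r k) *\<^sub>v w) $ i \<noteq> 0"
      using vw_c[of "r k"] by (metis carrier_vecD eq_vecI index_zero_vec)
    have Sx: "(S (f, 0) *\<^sub>v x) $ j = pairing (e j) f * x $ j" if j: "j < m" for f j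
    proof -
      have "(S (f, 0) *\<^sub>v x) $ j =
          (\<Sum>l<m. (if e j = e l then pairing (e j) f * \<mu> (0 + r l + r j) else 0) * x $ l)"
        using j x by (simp add: S_def scalar_prod_def atLeast0LessThan)
      also have "\<dots> = (\<Sum>l<m. if l = j then pairing (e j) f * x $ j else 0)"
        using j e_inj by (intro sum.cong) (auto simp: add_self_zero \<mu>0)
      finally show ?thesis using j by simp
    qed
    have zero: "(\<Sum>j<m. M $$ (i, j) * (pairing (e j) f * x $ j)) = 0" for f
    proof -
      have "M *\<^sub>v (S (f, 0) *\<^sub>v x) = (M * S (f, 0)) *\<^sub>v x"
        using M S x by (intro assoc_mult_mat_vec[of _ n m _ m, symmetric]) auto
      also have "\<dots> = \<rho> (f, 0) *\<^sub>v (M *\<^sub>v x)"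
        unfolding twine[symmetric] using M x by (intro assoc_mult_mat_vec[of _ n n _ m]) auto
      also have "\<dots> = 0\<^sub>v n" unfolding Mx
        using carrier_matD(1)[OF car[of "(f, 0)"]] by (intro eq_vecI) auto
      finally have "(M *\<^sub>v (S (f, 0) *\<^sub>v x)) $ i = 0" using i by simp
      moreover have "S (f, 0) *\<^sub>v x \<in> carrier_vec m" using S x by (intro mult_mat_vec_carrier[of _ m m]) auto
      moreover have "(M *\<^sub>v y) $ i = (\<Sum>j<m. M $$ (i, j) * y $ j)" if "y \<in> carrier_vec m" for y
        using that i M by (simp add: scalar_prod_def atLeast0LessThan)
      ultimately have "(\<Sum>j<m. M $$ (i, j) * (S (f, 0) *\<^sub>v x) $ j) = 0" by metis
      then show ?thesis using Sx by (simp del: index_mult_mat_vec)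
    qed
    define N :: complex where "N = of_nat (card (UNIV :: ('v \<Rightarrow> bit) set))"
    \<comment> \<open>Orthogonality isolates the \<open>k\<close>-th term of a linear relation between the columns of \<open>M\<close>.\<close>
    have "0 = (\<Sum>f\<in>UNIV. pairing (e k) f * (\<Sum>j<m. M $$ (i, j) * (pairing (e j) f * x $ j)))"
      by (simp add: zero)
    also have "\<dots> = (\<Sum>j<m. \<Sum>f\<in>UNIV. M $$ (i, j) * x $ j * (pairing (e k) f * pairing (e j) f))"
      unfolding sum_distrib_left by (subst sum.swap) (simp add: mult_ac)
    also have "\<dots> = (\<Sum>j<m. if j = k then M $$ (i, k) * x $ k * N else 0)"
      unfolding sum_distrib_left[symmetric] pairing_orthogonality N_def
      using k e_inj by (intro sum.cong) auto
    also have "\<dots> = M $$ (i, k) * x $ k * N" using k by simp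
    finally have "M $$ (i, k) * x $ k * N = 0" ..
    moreover have "M $$ (i, k) \<noteq> 0" using i k by (simp add: M_def del: index_mult_mat_vec)
    ultimately show "x $ k = 0\<^sub>v m $ k" using k by (simp add: N_def)
  qed (use x in simp)
  have m: "m \<noteq> 0" unfolding m_def using self_mem_translates[of u] by auto
  have "mat_trace (\<rho> (f, t)) = \<mu> t * orbit_character u (f, t)" for f t
  proof -
    have "mat_trace (\<rho> (f, t)) = mat_trace (S (f, t))"
      using irr M S twine ker m
      by (rule irreducible_trace_eq_intertwined) (auto simp: function_semidirect_def)
    also have "\<dots> = (\<Sum>i<m. if translate t u = u then pairing (e i) f * \<mu> t else 0)"
      unfolding mat_trace_def S_def
      using translate_stabilizes_translates_iff[OF e_mem]
      by (intro sum.cong) (auto simp: eq_commute[of "e _"] add.assoc add_self_zero)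
    also have "\<dots> = \<mu> t * orbit_character u (f, t)"
      using sum.reindex_bij_betw[OF e, of "\<lambda>u'. pairing u' f"]
      by (simp add: orbit_character_def mult.commute[of _ "\<mu> t"] flip: sum_distrib_left)
    finally show ?thesis .
  qed
  with \<mu>(1) \<mu>_mult show thesis by (intro that[of u \<mu>]) (auto simp: T_def)
qed

section \<open>Invariant characters under an odd fixed-point-free action\<close>

text \<open>
  Adjoining an element to a subgroup that does not contain it doubles the subgroup.
\<close>

lemma exponent_two_card_power_of_two:
  assumes add_self_zero: "\<And>t :: 'v::{ab_group_add,finite}. t + t = 0"
  shows "\<exists>k. card (UNIV :: 'v set) = 2 ^ k"
proof -
  have "\<exists>H k. F \<subseteq> H \<and> 0 \<in> H \<and> (\<forall>x\<in>H. \<forall>y\<in>H. x + y \<in> H) \<and> card H = 2 ^ k" for F :: "'v set"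
    using finite[of F]
  proof (induction F)
    case empty
    show ?case by (rule exI[of _ "{0}"]) (auto intro!: exI[of _ 0])
  next
    case (insert x F)
    then obtain H k where H: "F \<subseteq> H" "0 \<in> H" "card H = 2 ^ k"
      and add: "\<And>y z. y \<in> H \<Longrightarrow> z \<in> H \<Longrightarrow> y + z \<in> H" by blast
    show ?case
    proof (cases "x \<in> H")
      case True
      then have "insert x F \<subseteq> H" using H by simp
      then show ?thesis using H add by (intro exI[of _ H] exI[of _ k]) auto
    next
      case False
      define H' where "H' = H \<union> (+) x ` H"
      have disj: "H \<inter> (+) x ` H = {}"
      proof -
        have False if "y \<in> H" "x + y \<in> H" for y
          using add[OF that(2) that(1)] False add_self_zero[of y] by (simp add: add.assoc)
        then show ?thesis by auto
      qed
      have "card H' = 2 ^ Suc k"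
        using disj H by (simp add: H'_def card_Un_disjoint card_image)
      moreover have "y + z \<in> H'" if y: "y \<in> H'" and z: "z \<in> H'" for y z
      proof -
        have xx: "x + (x + c) = c" for c by (simp add: add_self_zero flip: add.assoc)
        consider "y \<in> H" "z \<in> H" | z' where "y \<in> H" "z' \<in> H" "z = x + z'"
          | y' where "y' \<in> H" "y = x + y'" "z \<in> H"
          | y' z' where "y' \<in> H" "y = x + y'" "z' \<in> H" "z = x + z'"
          using y z unfolding H'_def by blast
        then show ?thesis
        proof cases
          case 1
          then show ?thesis using add by (simp add: H'_def)
        next
          case 2
          then have "y + z = x + (y + z')" by (simp add: add.left_commute)
          then show ?thesis using add 2 by (auto simp: H'_def)
        next
          case 3
          then have "y + z = x + (y' + z)" by (simp add: add.assoc)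
          then show ?thesis using add 3 by (auto simp: H'_def)
        next
          case 4
          then have "y + z = x + (x + (y' + z'))" by (simp add: ac_simps)
          then have "y + z = y' + z'" by (simp only: xx)
          then show ?thesis using add[OF 4(1) 4(3)] unfolding H'_def by (metis UnI1)
        qed
      qed
      moreover have "insert x F \<subseteq> H'" "0 \<in> H'"
        using H by (auto simp: H'_def intro!: image_eqI[of x _ 0])
      ultimately show ?thesis by (intro exI[of _ H'] exI[of _ "Suc k"]) auto
    qed
  qed
  from this[of UNIV] show ?thesis by (auto simp: top.extremum_unique)
qed

lemma sum_const_exponent_two:
  fixes v :: "'v::ab_group_add"
  assumes "finite F" "v + v = 0"
  shows "(\<Sum>a\<in>F. v) = (if odd (card F) then v else 0)"
  using assms by (induction F) auto

locale odd_fixed_point_free_action =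
  fixes A :: "('a, 'k) monoid_scheme"
    and scale :: "bit \<Rightarrow> 'v \<Rightarrow> 'v::{ab_group_add, finite}"
    and act :: "'a \<Rightarrow> 'v \<Rightarrow> 'v"
  assumes group_A: "group A" and finite_A: "finite (carrier A)" and odd_A: "odd (Coset.order A)"
    and vector_space: "vector_space scale"
    and linear: "linear_action A scale act"
    and fixed_point_free: "fixed_point_free A act"
begin

lemma add_self_zero: "t + t = (0 :: 'v)"
proof -
  interpret vector_space scale by (rule vector_space)
  have "t + t = scale (1 + 1) t" by (simp only: scale_left_distrib scale_one)
  also have "\<dots> = 0" by (simp add: bit_add_self)
  finally show ?thesis .
qed

lemma group_action_act: "group_action A UNIV act"
  using linear by (simp add: linear_action_def)

lemma act_mult: "a \<in> carrier A \<Longrightarrow> b \<in> carrier A \<Longrightarrow> act (a \<otimes>\<^bsub>A\<^esub> b) x = act a (act b x)"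
  using group_action.composition_rule[OF group_action_act, of x a b] by simp

lemma act_one: "act \<one>\<^bsub>A\<^esub> x = x"
  using group_action.id_eq_one[OF group_action_act] by (metis UNIV_I restrict_apply)

lemma act_inv_act:
  assumes "a \<in> carrier A"
  shows "act (inv\<^bsub>A\<^esub> a) (act a x) = x" "act a (act (inv\<^bsub>A\<^esub> a) x) = x"
  using assms act_mult[of "inv\<^bsub>A\<^esub> a" a x] act_mult[of a "inv\<^bsub>A\<^esub> a" x] act_one group_A
  by (simp_all add: group.l_inv group.r_inv)

lemma inv_closed: "a \<in> carrier A \<Longrightarrow> inv\<^bsub>A\<^esub> a \<in> carrier A"
  using group_A by simp

lemma bij_act: "a \<in> carrier A \<Longrightarrow> bij (act a)"
  by (rule o_bij[where g = "act (inv\<^bsub>A\<^esub> a)"]) (auto simp: act_inv_act)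

lemma act_add: "a \<in> carrier A \<Longrightarrow> act a (x + y) = act a x + act a y"
  using linear by (auto simp: linear_action_def Vector_Spaces.linear_iff)

lemma act_zero: "a \<in> carrier A \<Longrightarrow> act a 0 = 0"
  using act_add[of a 0 0] by simp

lemma act_sum: "a \<in> carrier A \<Longrightarrow> act a (\<Sum>i\<in>I. h i) = (\<Sum>i\<in>I. act a (h i))"
  by (induction I rule: infinite_finite_induct) (auto simp: act_zero act_add)

lemma sum_shift:
  assumes "b \<in> carrier A"
  shows "(\<Sum>a\<in>carrier A. h (b \<otimes>\<^bsub>A\<^esub> a)) = (\<Sum>a\<in>carrier A. h a)"
  using assms group_A
  by (intro sum.reindex_bij_witness[where i = "\<lambda>a. inv\<^bsub>A\<^esub> b \<otimes>\<^bsub>A\<^esub> a" and j = "\<lambda>a. b \<otimes>\<^bsub>A\<^esub> a"])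
     (auto simp: group.inv_solve_left' group.is_monoid monoid.m_closed group.r_inv group.l_inv simp flip: monoid.m_assoc)

lemma orbit_sum_eq_zero: "(\<Sum>a\<in>carrier A. act a x) = 0"
proof -
  have "act b (\<Sum>a\<in>carrier A. act a x) = (\<Sum>a\<in>carrier A. act a x)" if b: "b \<in> carrier A" for b
  proof -
    have "act b (\<Sum>a\<in>carrier A. act a x) = (\<Sum>a\<in>carrier A. act (b \<otimes>\<^bsub>A\<^esub> a) x)"
      using b by (simp add: act_sum act_mult)
    also have "\<dots> = (\<Sum>a\<in>carrier A. act a x)" by (rule sum_shift[OF b])
    finally show ?thesis .
  qed
  then have "(\<Sum>a\<in>carrier A. act a x) \<in> {v. \<forall>a\<in>carrier A. act a v = v}" by blast
  then show ?thesis using fixed_point_free by (simp only: fixed_point_free_def singleton_iff)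
qed

lemma sum_const: "(\<Sum>a\<in>carrier A. x) = (x :: 'v)"
  using sum_const_exponent_two[OF finite_A add_self_zero] odd_A by (simp add: Coset.order_def)

definition fixed_functions :: "('v \<Rightarrow> bit) set" where
  "fixed_functions = {u. \<forall>a\<in>carrier A. u \<circ> act (inv\<^bsub>A\<^esub> a) = u}"

lemma translate_comp_act:
  assumes "a \<in> carrier A"
  shows "translate t u \<circ> act (inv\<^bsub>A\<^esub> a) = translate (act a t) (u \<circ> act (inv\<^bsub>A\<^esub> a))"
  using assms by (simp add: translate_def fun_eq_iff act_add inv_closed act_inv_act)

lemma pairing_comp_act:
  "a \<in> carrier A \<Longrightarrow> pairing (u \<circ> act (inv\<^bsub>A\<^esub> a)) (f \<circ> act (inv\<^bsub>A\<^esub> a)) = pairing u f"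
  by (rule pairing_comp[OF bij_act[OF inv_closed]])

lemma stabilizer_sum:
  assumes "\<And>i. i \<in> I \<Longrightarrow> translate (h i) u = u"
  shows "translate (\<Sum>i\<in>I. h i) u = u"
  using assms by (induction I rule: infinite_finite_induct) (auto simp flip: translate_translate)

lemma translate_eq_iff:
  fixes s t :: 'v
  shows "translate s u = translate t u \<longleftrightarrow> translate (s + t) u = u"
proof -
  have "translate t (translate s u) = translate (s + t) u" "translate t (translate t u) = u"
    "translate t (translate (s + t) u) = translate s u"
    by (simp_all add: translate_translate add_self_zero add.commute[of s t])
       (simp add: add_self_zero flip: add.assoc)
  then show ?thesis by metis
qed

text \<open>
  If \<open>a\<close> moves \<open>u\<close> to its translate by \<open>d a\<close>, then \<open>d\<close> is a cocycle with values in \<open>V\<close> modulo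
  the stabilizer of \<open>u\<close>.  Since \<open>card A\<close> is odd, the sum of all its values exhibits it as a
  coboundary: it is the translation that makes \<open>u\<close> fixed.
\<close>

lemma fixed_function_in_stable_translates:
  assumes stable: "\<And>a. a \<in> carrier A \<Longrightarrow> u \<circ> act (inv\<^bsub>A\<^esub> a) \<in> translates u"
  obtains u' where "u' \<in> translates u" "u' \<in> fixed_functions"
proof -
  have "\<exists>d. u \<circ> act (inv\<^bsub>A\<^esub> a) = translate d u" if "a \<in> carrier A" for a
    using stable[OF that] by (auto simp: translates_def)
  then obtain d where d: "\<And>a. a \<in> carrier A \<Longrightarrow> u \<circ> act (inv\<^bsub>A\<^esub> a) = translate (d a) u" by metis
  define s where "s = (\<Sum>a\<in>carrier A. d a)"
  have "translate s u \<circ> act (inv\<^bsub>A\<^esub> b) = translate s u" if b: "b \<in> carrier A" for b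
  proof -
    have cocycle: "translate (act b (d a) + d b + d (b \<otimes>\<^bsub>A\<^esub> a)) u = u" if a: "a \<in> carrier A" for a
    proof -
      have ba: "b \<otimes>\<^bsub>A\<^esub> a \<in> carrier A" using group_A a b by (simp add: group.is_monoid monoid.m_closed)
      have "inv\<^bsub>A\<^esub> (b \<otimes>\<^bsub>A\<^esub> a) = inv\<^bsub>A\<^esub> a \<otimes>\<^bsub>A\<^esub> inv\<^bsub>A\<^esub> b"
        using group.inv_mult_group[OF group_A b a] .
      then have "translate (d (b \<otimes>\<^bsub>A\<^esub> a)) u = (u \<circ> act (inv\<^bsub>A\<^esub> a)) \<circ> act (inv\<^bsub>A\<^esub> b)"
        using d[OF ba] a b by (simp add: fun_eq_iff act_mult inv_closed)
      also have "\<dots> = translate (act b (d a) + d b) u"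
        by (simp add: d[OF a] translate_comp_act[OF b] d[OF b] translate_translate)
      finally show ?thesis using translate_eq_iff by metis
    qed
    have "act b s + d b + s = (\<Sum>a\<in>carrier A. act b (d a) + d b + d (b \<otimes>\<^bsub>A\<^esub> a))"
      using b sum_shift[OF b, of d] sum_const[of "d b"] by (simp add: sum.distrib s_def act_sum)
    then have "translate (act b s + d b + s) u = u"
      using stabilizer_sum[of "carrier A" "\<lambda>a. act b (d a) + d b + d (b \<otimes>\<^bsub>A\<^esub> a)" u] cocycle by simp
    then have "translate (act b s + d b) u = translate s u" by (simp add: translate_eq_iff)
    then show ?thesis by (simp add: translate_comp_act[OF b] d[OF b] translate_translate)
  qed
  then show thesis by (intro that[of "translate s u"]) (auto simp: translates_def fixed_functions_def)
qed

text \<open>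
  If \<open>u\<close> and its translate by \<open>s\<close> are both fixed, then every \<open>act a s + s\<close> stabilizes \<open>u\<close>.  The
  sum of these elements over \<open>A\<close> is \<open>s\<close>.
\<close>

lemma fixed_translate_eq:
  assumes "u \<in> fixed_functions" "translate s u \<in> fixed_functions"
  shows "translate s u = u"
proof -
  have "translate (act a s + s) u = u" if a: "a \<in> carrier A" for a
    using assms a translate_comp_act[OF a, of s u] translate_eq_iff[of "act a s" u s]
    by (simp add: fixed_functions_def)
  then have "translate (\<Sum>a\<in>carrier A. act a s + s) u = u" by (rule stabilizer_sum)
  then show ?thesis by (simp add: sum.distrib orbit_sum_eq_zero sum_const)
qed

lemma act_stabilizer:
  assumes "u \<in> fixed_functions" "a \<in> carrier A"
  shows "translate (act a t) u = u \<longleftrightarrow> translate t u = u"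
proof -
  have "translate (act a t) u = translate t u \<circ> act (inv\<^bsub>A\<^esub> a)"
    using assms by (simp add: translate_comp_act fixed_functions_def)
  moreover have "translate t u \<circ> act (inv\<^bsub>A\<^esub> a) = u \<circ> act (inv\<^bsub>A\<^esub> a) \<longleftrightarrow> translate t u = u"
    using bij_act[OF inv_closed[OF assms(2)]]
    by (metis bij_is_surj fun.map_ident_strong surj_fun_eq comp_def)
  ultimately show ?thesis using assms by (simp add: fixed_functions_def)
qed

text \<open>
  The product of \<open>\<mu> (act a t)\<close> over \<open>A\<close> is the value of \<open>\<mu>\<close> at a sum that vanishes, so it
  is \<open>1\<close>; it is also an odd power of the sign \<open>\<mu> t\<close>.
\<close>

lemma invariant_sign_character_trivial:
  fixes \<mu> :: "'v \<Rightarrow> complex"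
  assumes u: "u \<in> fixed_functions"
    and sign: "\<And>t. translate t u = u \<Longrightarrow> \<mu> t \<in> {1, -1}"
    and mult: "\<And>s t. translate s u = u \<Longrightarrow> translate t u = u \<Longrightarrow> \<mu> (s + t) = \<mu> s * \<mu> t"
    and inv: "\<And>a t. a \<in> carrier A \<Longrightarrow> translate t u = u \<Longrightarrow> \<mu> (act a t) = \<mu> t"
    and t: "translate t u = u"
  shows "\<mu> t = 1"
proof -
  have \<mu>0: "\<mu> 0 = 1" using mult[of 0 0] sign[of 0] by auto
  have "\<mu> (\<Sum>a\<in>F. act a t) = \<mu> t ^ card F" if "finite F" "F \<subseteq> carrier A" for F
    using that
  proof (induction F)
    case (insert a F)
    have "translate (\<Sum>a\<in>F. act a t) u = u"
      using insert.prems t by (intro stabilizer_sum) (auto simp: act_stabilizer[OF u])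
    then show ?case using insert t by (simp add: mult act_stabilizer[OF u] inv)
  qed (simp add: \<mu>0)
  from this[OF finite_A] have "\<mu> t ^ Coset.order A = 1" by (simp add: orbit_sum_eq_zero \<mu>0 Coset.order_def)
  then show ?thesis using sign[OF t] odd_A by auto
qed

lemma orbit_character_invariant:
  assumes u: "u \<in> fixed_functions" and a: "a \<in> carrier A"
  shows "orbit_character u (semidirect_action A act a g) = orbit_character u g"
proof -
  obtain f t where g: "g = (f, t)" by (cases g)
  have ia: "inv\<^bsub>A\<^esub> a \<in> carrier A" "inv\<^bsub>A\<^esub> (inv\<^bsub>A\<^esub> a) = a"
    using group_A a by (auto simp: group.inv_inv)
  have stable: "u' \<circ> act (inv\<^bsub>A\<^esub> b) \<in> translates u" if "u' \<in> translates u" "b \<in> carrier A" for u' b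
    using that u translate_comp_act[of b _ u] by (auto simp: translates_def fixed_functions_def)
  have "(\<Sum>u'\<in>translates u. pairing u' f) = (\<Sum>u'\<in>translates u. pairing u' (f \<circ> act (inv\<^bsub>A\<^esub> a)))"
    using stable[OF _ a] stable[OF _ ia(1)] a ia(2)
    by (intro sum.reindex_bij_witness[where i = "\<lambda>u'. u' \<circ> act a" and j = "\<lambda>u'. u' \<circ> act (inv\<^bsub>A\<^esub> a)"])
       (auto simp: pairing_comp_act act_inv_act fun_eq_iff)
  then show ?thesis using act_stabilizer[OF u a, of t]
    by (simp add: g semidirect_action_def orbit_character_def)
qed

text \<open>
  Fourier inversion on \<open>B\<close> turns invariance of a character into invariance of the data \<open>(u, \<mu>)\<close>
  behind it: the orbit of \<open>u\<close> is stable, and \<open>\<mu>\<close> is invariant once \<open>u\<close> is replaced by the fixed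
  function in its orbit.
\<close>

lemma Irr_inv_eq:
  "Irr_inv function_semidirect (semidirect_action A act) (carrier A) = orbit_character ` fixed_functions"
proof (intro equalityI subsetI)
  fix \<chi> assume "\<chi> \<in> orbit_character ` fixed_functions"
  then show "\<chi> \<in> Irr_inv function_semidirect (semidirect_action A act) (carrier A)"
    by (auto simp: Irr_inv_def orbit_character_in_Irr orbit_character_invariant)
next
  fix \<chi> assume "\<chi> \<in> Irr_inv function_semidirect (semidirect_action A act) (carrier A)"
  then obtain n \<rho> where irr: "irreducible_representation function_semidirect n \<rho>"
    and \<chi>: "\<chi> = (\<lambda>g\<in>carrier function_semidirect. mat_trace (\<rho> g))"
    and inv: "\<And>a g. a \<in> carrier A \<Longrightarrow> \<chi> (semidirect_action A act a g) = \<chi> g"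
    by (auto simp: Irr_inv_def Irr_def function_semidirect_def)
  obtain u \<mu> where sign: "\<And>t. translate t u = u \<Longrightarrow> \<mu> t \<in> {1, -1}"
    and mult: "\<And>s t. translate s u = u \<Longrightarrow> translate t u = u \<Longrightarrow> \<mu> (s + t) = \<mu> s * \<mu> t"
    and tr: "\<And>f t. mat_trace (\<rho> (f, t)) = \<mu> t * orbit_character u (f, t)"
    using irreducible_character_eq_twisted_orbit_character[OF add_self_zero irr] by blast
  have \<chi>u: "\<chi> (f, t) = \<mu> t * orbit_character u (f, t)" for f t
    by (simp add: \<chi> function_semidirect_def tr)
  define N :: complex where "N = of_nat (card (UNIV :: ('v \<Rightarrow> bit) set))"
  have N: "N \<noteq> 0" by (simp add: N_def)
  have weight: "(\<Sum>f\<in>UNIV. pairing u' f * \<chi> (f, t)) =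
      \<mu> t * (if translate t u = u \<and> u' \<in> translates u then N else 0)" for u' t
    unfolding \<chi>u N_def sum_pairing_orbit_character[symmetric] by (simp add: sum_distrib_left mult_ac)
  have weight_inv: "(\<Sum>f\<in>UNIV. pairing (u' \<circ> act (inv\<^bsub>A\<^esub> a)) f * \<chi> (f, act a t)) =
      (\<Sum>f\<in>UNIV. pairing u' f * \<chi> (f, t))" if a: "a \<in> carrier A" for u' a t
  proof -
    have "bij (\<lambda>f. f \<circ> act (inv\<^bsub>A\<^esub> a) :: 'v \<Rightarrow> bit)"
      using a by (intro o_bij[where g = "\<lambda>f. f \<circ> act a"]) (auto simp: fun_eq_iff act_inv_act)
    from sum.reindex_bij_betw[OF this, symmetric]
    have "(\<Sum>f\<in>UNIV. pairing (u' \<circ> act (inv\<^bsub>A\<^esub> a)) f * \<chi> (f, act a t)) =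
        (\<Sum>f\<in>UNIV. pairing (u' \<circ> act (inv\<^bsub>A\<^esub> a)) (f \<circ> act (inv\<^bsub>A\<^esub> a)) * \<chi> (f \<circ> act (inv\<^bsub>A\<^esub> a), act a t))" .
    also have "\<dots> = (\<Sum>f\<in>UNIV. pairing u' f * \<chi> (f, t))"
    proof -
      have "\<chi> (f \<circ> act (inv\<^bsub>A\<^esub> a), act a t) = \<chi> (f, t)" for f
        using inv[OF a, of "(f, t)"] by (simp add: semidirect_action_def)
      then show ?thesis by (simp add: pairing_comp_act[OF a])
    qed
    finally show ?thesis .
  qed
  have \<mu>0: "\<mu> 0 = 1" using mult[of 0 0] sign[of 0] by auto
  \<comment> \<open>Fourier coefficients at \<open>t = 0\<close> detect the orbit of \<open>u\<close>.\<close>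
  have "u \<circ> act (inv\<^bsub>A\<^esub> a) \<in> translates u" if a: "a \<in> carrier A" for a
    using weight_inv[OF a, of u 0] N self_mem_translates[of u]
    by (simp add: act_zero[OF a] weight \<mu>0 split: if_splits)
  then obtain u' where u': "u' \<in> translates u" "u' \<in> fixed_functions"
    by (rule fixed_function_in_stable_translates)
  have stab: "translate t u' = u' \<longleftrightarrow> translate t u = u" for t
    by (rule translate_stabilizes_translates_iff[OF u'(1)])
  have "\<mu> t = 1" if t: "translate t u = u" for t
  proof (rule invariant_sign_character_trivial[OF u'(2), of \<mu>])
    fix a t assume a: "a \<in> carrier A" and t: "translate t u' = u'"
    then show "\<mu> (act a t) = \<mu> t"
      using weight_inv[OF a, of u' t] N u' act_stabilizer[OF u'(2) a, of t] stab
      by (simp add: weight fixed_functions_def)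
  qed (use sign mult stab t in auto)
  then have "\<chi> = orbit_character u"
    by (auto simp: fun_eq_iff \<chi>u orbit_character_def)
  then show "\<chi> \<in> orbit_character ` fixed_functions"
    using u'(2) orbit_character_translates[OF u'(1)] by (intro image_eqI[of _ _ u']) simp_all
qed

lemma inj_on_orbit_character: "inj_on orbit_character fixed_functions"
proof (rule inj_onI)
  fix u u' assume u: "u \<in> fixed_functions" "u' \<in> fixed_functions"
    and eq: "orbit_character u = orbit_character u'"
  have "(\<Sum>f\<in>UNIV. pairing u' f * orbit_character u (f, 0)) \<noteq> 0"
    unfolding eq sum_pairing_orbit_character by (simp add: self_mem_translates)
  then have "u' \<in> translates u"
    unfolding sum_pairing_orbit_character by (simp split: if_splits)
  then obtain s where "u' = translate s u" by (auto simp: translates_def)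
  then show "u = u'" using fixed_translate_eq u by metis
qed

end

section \<open>The fixed subgroup and the vanishing character\<close>

lemma card_bit_functions: "card (UNIV :: ('v::finite \<Rightarrow> bit) set) = 2 ^ card (UNIV :: 'v set)"
proof -
  have "bij (\<lambda>f :: 'v \<Rightarrow> bit. {x. f x = 1})"
    by (rule o_bij[where g = "\<lambda>X x. if x \<in> X then 1 else 0"]) (auto simp: fun_eq_iff)
  then have "card (UNIV :: ('v \<Rightarrow> bit) set) = card (UNIV :: 'v set set)"
    by (rule bij_betw_same_card)
  then show ?thesis using card_Pow[of "UNIV :: 'v set"] by simp
qed

context odd_fixed_point_free_action
begin

lemma semidirect_action_coprime:
  "coprime_action A (function_semidirect :: (('v \<Rightarrow> bit) \<times> 'v) monoid) (semidirect_action A act)"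
proof -
  let ?G = "function_semidirect :: (('v \<Rightarrow> bit) \<times> 'v) monoid"
  let ?\<phi> = "semidirect_action A act"
  have carG: "carrier ?G = UNIV" by (simp add: function_semidirect_def)
  have \<phi>_mult: "?\<phi> (a \<otimes>\<^bsub>A\<^esub> b) g = ?\<phi> a (?\<phi> b g)" if "a \<in> carrier A" "b \<in> carrier A" for a b g
    using that group.inv_mult_group[OF group_A that]
    by (cases g) (simp add: semidirect_action_def fun_eq_iff act_mult inv_closed)
  have \<phi>_one: "?\<phi> \<one>\<^bsub>A\<^esub> g = g" for g
    using monoid.inv_one[OF group.is_monoid[OF group_A]]
    by (cases g) (simp add: semidirect_action_def fun_eq_iff act_one)
  have bij: "bij (?\<phi> a)" if a: "a \<in> carrier A" for a
    using a \<phi>_mult[OF a inv_closed[OF a]] \<phi>_mult[OF inv_closed[OF a] a] \<phi>_one group_A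
    by (intro o_bij[where g = "?\<phi> (inv\<^bsub>A\<^esub> a)"]) (auto simp: group.l_inv group.r_inv)
  have hom: "?\<phi> a (g \<otimes>\<^bsub>?G\<^esub> h) = ?\<phi> a g \<otimes>\<^bsub>?G\<^esub> ?\<phi> a h" if "a \<in> carrier A" for a g h
    using that by (cases g; cases h)
      (simp add: semidirect_action_def function_semidirect_def fun_eq_iff act_add act_inv_act inv_closed)
  have aut: "?\<phi> a \<in> auto ?G" if "a \<in> carrier A" for a
    using hom[OF that] bij[OF that] by (auto simp: auto_def hom_def Bij_def carG)
  have "?\<phi> \<in> Group.hom A (AutoGroup ?G)"
    using aut \<phi>_mult
    by (auto simp: Group.hom_def AutoGroup_def BijGroup_def auto_def carG compose_def fun_eq_iff)
  then have "acts_by_automorphisms A ?G ?\<phi>"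
    using group_A group.AutoGroup[OF group_function_semidirect]
    by (auto simp: acts_by_automorphisms_def group_hom_def group_hom_axioms_def)
  moreover have "coprime (Coset.order A) (Coset.order ?G)"
  proof -
    obtain k where "card (UNIV :: 'v set) = 2 ^ k"
      using exponent_two_card_power_of_two[OF add_self_zero] by blast
    then have "Coset.order ?G = 2 ^ (2 ^ k + k)"
      by (simp add: Coset.order_def carG card_bit_functions power_add
          flip: UNIV_Times_UNIV add: card_cartesian_product)
    then show ?thesis using odd_A by simp
  qed
  ultimately show ?thesis using finite_A by (simp add: coprime_action_def carG)
qed

abbreviation fixed_group :: "(('v \<Rightarrow> bit) \<times> 'v) monoid" where
  "fixed_group \<equiv> fixed_subgroup function_semidirect (semidirect_action A act) (carrier A)"

lemma carrier_fixed_group: "carrier fixed_group = fixed_functions \<times> {0}"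
proof -
  have "{t. \<forall>a\<in>carrier A. act a t = t} = {0}"
    using fixed_point_free by (simp add: fixed_point_free_def)
  then show ?thesis
    by (auto simp: fixed_subgroup_def function_semidirect_def semidirect_action_def fixed_functions_def
        split: prod.splits)
qed

lemma fixed_functions_add:
  "f \<in> fixed_functions \<Longrightarrow> g \<in> fixed_functions \<Longrightarrow> (\<lambda>x. f x + g x) \<in> fixed_functions"
  by (simp add: fixed_functions_def fun_eq_iff)

lemma fixed_group_mult: "(f, 0) \<otimes>\<^bsub>fixed_group\<^esub> (g, 0) = (\<lambda>x. f x + g x, 0)"
  by (simp add: fixed_subgroup_def function_semidirect_def)

lemma fixed_group_one: "\<one>\<^bsub>fixed_group\<^esub> = (\<lambda>_. 0, 0)"
  by (simp add: fixed_subgroup_def function_semidirect_def)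

lemma fixed_group_square:
  "c \<in> carrier fixed_group \<Longrightarrow> c \<otimes>\<^bsub>fixed_group\<^esub> c = \<one>\<^bsub>fixed_group\<^esub>"
  by (auto simp: carrier_fixed_group fixed_group_mult fixed_group_one bit_add_self)

lemma comm_group_fixed_group: "comm_group fixed_group"
proof (rule comm_groupI)
  show "\<exists>y\<in>carrier fixed_group. y \<otimes>\<^bsub>fixed_group\<^esub> x = \<one>\<^bsub>fixed_group\<^esub>" if "x \<in> carrier fixed_group" for x
    using that fixed_group_square by blast
qed (auto simp: carrier_fixed_group fixed_group_mult fixed_group_one fixed_functions_add ac_simps,
     simp add: fixed_functions_def fun_eq_iff)

lemma elementary_abelian_fixed_group: "elementary_abelian fixed_group"
proof -
  interpret comm_group fixed_group by (rule comm_group_fixed_group)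
  have "c [^]\<^bsub>fixed_group\<^esub> (2::nat) = \<one>\<^bsub>fixed_group\<^esub>" if "c \<in> carrier fixed_group" for c
    using fixed_group_square[OF that] that by (simp add: numeral_2_eq_2)
  then show ?thesis
    unfolding elementary_abelian_def using comm_group_fixed_group two_is_prime_nat by blast
qed

lemma order_fixed_group_abelianization:
  "Coset.order (fixed_group Mod derived fixed_group (carrier fixed_group)) = card fixed_functions"
proof -
  interpret comm_group fixed_group by (rule comm_group_fixed_group)
  have "derived fixed_group (carrier fixed_group) = {\<one>\<^bsub>fixed_group\<^esub>}"
    by (rule derived_eq_singleton) simp
  moreover have "card (rcosets\<^bsub>fixed_group\<^esub> {\<one>\<^bsub>fixed_group\<^esub>}) = Coset.order fixed_group"
    using lagrange[OF triv_subgroup] by simp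
  ultimately show ?thesis
    by (simp add: Coset.order_def FactGroup_def carrier_fixed_group card_cartesian_product)
qed

lemma delta_in_fixed_functions: "(\<lambda>x. if x = 0 then 1 else 0) \<in> fixed_functions"
proof -
  have "act (inv\<^bsub>A\<^esub> a) x = 0 \<longleftrightarrow> x = 0" if "a \<in> carrier A" for a x
    using act_inv_act(2)[OF that, of x] act_zero[OF that] act_zero[OF inv_closed[OF that]] by metis
  then show ?thesis by (simp add: fixed_functions_def fun_eq_iff)
qed

text \<open>
  The translates of the function supported at \<open>0\<close> are the functions supported at one point, each
  occurring once.
\<close>

lemma delta_orbit_character:
  fixes f :: "'v \<Rightarrow> bit"
  shows "orbit_character (\<lambda>x. if x = 0 then 1 else 0) (f, 0) = (\<Sum>y\<in>UNIV. if f y = 1 then -1 else 1)"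
proof -
  define \<delta> :: "'v \<Rightarrow> 'v \<Rightarrow> bit" where "\<delta> y = (\<lambda>x. if x = y then 1 else 0)" for y
  have "x + t = 0 \<longleftrightarrow> x = t" for x t :: 'v
    using add_self_zero[of t] by (metis add_right_cancel)
  then have "translate t (\<delta> 0) = \<delta> t" for t
    by (simp add: translate_def \<delta>_def)
  then have "translates (\<delta> 0) = range \<delta>" by (simp add: translates_def)
  moreover have "inj \<delta>"
    by (rule injI) (metis \<delta>_def zero_neq_one)
  ultimately have "orbit_character (\<delta> 0) (f, 0) = (\<Sum>y\<in>UNIV. pairing (\<delta> y) f)"
    by (simp add: orbit_character_def sum.reindex)
  also have "\<dots> = (\<Sum>y\<in>UNIV. if f y = 1 then -1 else 1)"
    by (simp add: pairing_commute[of _ f] \<delta>_def pairing_delta)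
  finally show ?thesis by (simp add: \<delta>_def)
qed

lemma balanced_orbit_character_zero:
  assumes "balanced A act"
  obtains c where "c \<in> carrier fixed_group" "orbit_character (\<lambda>x. if x = 0 then 1 else 0) c = 0"
proof -
  obtain S where S: "\<And>a. a \<in> carrier A \<Longrightarrow> act a ` S = S" "2 * card S = card (UNIV :: 'v set)"
    using assms by (auto simp: balanced_def)
  define f :: "'v \<Rightarrow> bit" where "f = (\<lambda>x. if x \<in> S then 1 else 0)"
  have "act (inv\<^bsub>A\<^esub> a) x \<in> S \<longleftrightarrow> x \<in> S" if a: "a \<in> carrier A" for a x
    using S(1)[OF a] S(1)[OF inv_closed[OF a]] act_inv_act(2)[OF a, of x] by (metis imageI)
  then have "f \<in> fixed_functions" by (simp add: f_def fixed_functions_def fun_eq_iff)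
  moreover have "orbit_character (\<lambda>x. if x = 0 then 1 else 0) (f, 0) = 0"
  proof -
    have "(\<Sum>y\<in>UNIV. if f y = 1 then -1 else 1 :: complex) = (\<Sum>y\<in>UNIV. 1 - 2 * of_bool (y \<in> S))"
      by (intro sum.cong) (auto simp: f_def)
    also have "\<dots> = of_nat (card (UNIV :: 'v set)) - 2 * of_nat (card S)"
      by (simp add: sum_subtractf flip: sum_distrib_left)
    also have "\<dots> = 0" by (simp flip: S(2))
    finally show ?thesis by (simp add: delta_orbit_character)
  qed
  ultimately show thesis by (intro that[of "(f, 0)"]) (simp_all add: carrier_fixed_group)
qed

end

text \<open>
  Only the last step of the series matters.  The exceptional case is the empty series, where no
  step certifies irreducibility on the fixed subgroup.
\<close>

lemma GI_corresponds_cases_Irr: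
  assumes "GI_corresponds A G \<phi> K \<chi> \<psi>"
  shows "K = {\<one>\<^bsub>A\<^esub>} \<or> \<psi> \<in> Irr (fixed_subgroup G \<phi> K)"
  using assms by cases (auto simp: unique_constituent_not_dvd_def)

theorem theorem2p11:
  fixes A :: "('a, 'k) monoid_scheme"
    and scale :: "bit \<Rightarrow> 'v \<Rightarrow> 'v::{ab_group_add, finite}"
    and act :: "'a \<Rightarrow> 'v \<Rightarrow> 'v"
  assumes "group A" and "finite (carrier A)" and "odd (Coset.order A)"
    and "vector_space scale"
    and "linear_action A scale act"
    and "fixed_point_free A act"
    and "balanced A act"
  defines "G \<equiv> (function_semidirect :: (('v \<Rightarrow> bit) \<times> 'v) monoid)"
    and "\<phi> \<equiv> semidirect_action A act"
  defines "C \<equiv> fixed_subgroup G \<phi> (carrier A)"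
  shows "group G \<and> coprime_action A G \<phi> \<and>
    elementary_abelian C \<and>
    card (Irr_inv G \<phi> (carrier A)) = Coset.order (C Mod derived C (carrier C)) \<and>
    card (N_inv G \<phi> (carrier A)) < Coset.order (C Mod derived C (carrier C)) \<and>
    card (N_inv G \<phi> (carrier A)) \<noteq> Coset.order (C Mod derived C (carrier C)) \<and>
    (\<forall>star. is_GI_correspondence A G \<phi> star \<longrightarrow>
       \<not> (\<forall>\<chi>\<in>Irr_inv G \<phi> (carrier A).
             star \<chi> \<one>\<^bsub>C\<^esub> = 1 \<longleftrightarrow> (\<forall>c\<in>carrier C. \<chi> c \<noteq> 0)))"
proof -
  interpret odd_fixed_point_free_action A scale act
    using assms(1-6) by (rule odd_fixed_point_free_action.intro)
  define \<chi>\<^sub>0 :: "('v \<Rightarrow> bit) \<times> 'v \<Rightarrow> complex" where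
    "\<chi>\<^sub>0 = orbit_character (\<lambda>x. if x = 0 then 1 else 0)"
  have Irr: "Irr_inv G \<phi> (carrier A) = orbit_character ` fixed_functions"
    unfolding G_def \<phi>_def by (rule Irr_inv_eq)
  have order: "Coset.order (C Mod derived C (carrier C)) = card fixed_functions"
    unfolding C_def G_def \<phi>_def by (rule order_fixed_group_abelianization)
  have card_Irr: "card (Irr_inv G \<phi> (carrier A)) = card fixed_functions"
    unfolding Irr by (rule card_image[OF inj_on_orbit_character])
  have \<chi>0: "\<chi>\<^sub>0 \<in> Irr_inv G \<phi> (carrier A)"
    unfolding Irr \<chi>\<^sub>0_def using delta_in_fixed_functions by (rule imageI)
  obtain c where c: "c \<in> carrier C" "\<chi>\<^sub>0 c = 0"
    using balanced_orbit_character_zero[OF assms(7)] unfolding C_def G_def \<phi>_def \<chi>\<^sub>0_def by blast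
  have "\<chi>\<^sub>0 \<notin> N_inv G \<phi> (carrier A)"
    using c by (auto simp: N_inv_def C_def)
  then have "N_inv G \<phi> (carrier A) \<subset> Irr_inv G \<phi> (carrier A)"
    using \<chi>0 by (auto simp: N_inv_def)
  then have less: "card (N_inv G \<phi> (carrier A)) < card fixed_functions"
    using psubset_card_mono[of "Irr_inv G \<phi> (carrier A)"] by (simp add: Irr card_Irr[unfolded Irr])
  have "\<not> (\<forall>\<chi>\<in>Irr_inv G \<phi> (carrier A). star \<chi> \<one>\<^bsub>C\<^esub> = 1 \<longleftrightarrow> (\<forall>c\<in>carrier C. \<chi> c \<noteq> 0))"
    if star: "is_GI_correspondence A G \<phi> star" for star
  proof -
    \<comment> \<open>A trivial group fixes all of \<open>V\<close>, which would have a single element and no half.\<close>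
    have "carrier A \<noteq> {\<one>\<^bsub>A\<^esub>}"
    proof
      assume "carrier A = {\<one>\<^bsub>A\<^esub>}"
      then have "{v. \<forall>a\<in>carrier A. act a v = v} = UNIV" by (simp add: act_one)
      then have "(UNIV :: 'v set) = {0}" using fixed_point_free by (simp add: fixed_point_free_def)
      then have "card (UNIV :: 'v set) = card {0 :: 'v}" by (rule arg_cong)
      moreover have "even (card (UNIV :: 'v set))"
        using assms(7) by (metis balanced_def dvd_triv_left)
      ultimately show False by simp
    qed
    moreover have "GI_corresponds A G \<phi> (carrier A) \<chi>\<^sub>0 (star \<chi>\<^sub>0)"
      using star \<chi>0 by (simp add: is_GI_correspondence_def)
    ultimately have "star \<chi>\<^sub>0 \<in> Irr C"
      using GI_corresponds_cases_Irr by (fastforce simp: C_def)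
    then have "star \<chi>\<^sub>0 \<one>\<^bsub>C\<^esub> = 1"
      unfolding C_def G_def \<phi>_def
      using comm_group_fixed_group fixed_group_square
      by (intro Irr_degree_one_of_exponent_two) (auto simp: carrier_fixed_group)
    then show ?thesis using \<chi>0 c by blast
  qed
  then show ?thesis
    using group_function_semidirect semidirect_action_coprime elementary_abelian_fixed_group
      card_Irr order less
    by (auto simp: G_def \<phi>_def C_def)
qed

end
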